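(* Let $k \geq 2$ be an integer and let $G$ be a $k$-connected $(K_2 \cup kK_1)$-free graph with $\delta(G) \geq \frac{3(k-1)}{2}$ and $\alpha(G) \leq \frac{|V(G)|}{2}$. Then $G$ is hamiltonian or $G$ is the Petersen graph.
   Context: All graphs are finite, undirected and simple. $\delta(G)$ denotes the minimum degree and $\alpha(G)$ the independence number of $G$. For graphs $R, R'$, $R \cup R'$ is their disjoint union and $kR$ is the disjoint union of $k$ copies of $R$; $K_n$ is the complete graph on $n$ vertices. A graph $G$ is $R$-free if it contains no induced subgraph isomorphic to $R$. A graph is hamiltonian if it contains a spanning cycle. *)

theory Defs
  imports Complex_Main
begin

definition simple_graph :: "'a set \<Rightarrow> ('a \<Rightarrow> 'a \<Rightarrow> bool) \<Rightarrow> bool" where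
  "simple_graph V E \<longleftrightarrow> finite V \<and> (\<forall>x y. E x y \<longrightarrow> x \<in> V \<and> y \<in> V)
     \<and> (\<forall>x y. E x y \<longrightarrow> E y x) \<and> (\<forall>x. \<not> E x x)"

definition degree :: "'a set \<Rightarrow> ('a \<Rightarrow> 'a \<Rightarrow> bool) \<Rightarrow> 'a \<Rightarrow> nat" where
  "degree V E v = card {u \<in> V. E v u}"

definition min_degree :: "'a set \<Rightarrow> ('a \<Rightarrow> 'a \<Rightarrow> bool) \<Rightarrow> nat" where
  "min_degree V E = Min (degree V E ` V)"

definition independent_set :: "'a set \<Rightarrow> ('a \<Rightarrow> 'a \<Rightarrow> bool) \<Rightarrow> 'a set \<Rightarrow> bool" where
  "independent_set V E S \<longleftrightarrow> S \<subseteq> V \<and> (\<forall>x\<in>S. \<forall>y\<in>S. \<not> E x y)"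

definition independence_number :: "'a set \<Rightarrow> ('a \<Rightarrow> 'a \<Rightarrow> bool) \<Rightarrow> nat" where
  "independence_number V E = Max (card ` {S. independent_set V E S})"

definition connected_on :: "'a set \<Rightarrow> ('a \<Rightarrow> 'a \<Rightarrow> bool) \<Rightarrow> bool" where
  "connected_on W E \<longleftrightarrow> W \<noteq> {} \<and>
     (\<forall>u\<in>W. \<forall>v\<in>W. (\<lambda>x y. x \<in> W \<and> y \<in> W \<and> E x y)\<^sup>*\<^sup>* u v)"

definition k_connected :: "nat \<Rightarrow> 'a set \<Rightarrow> ('a \<Rightarrow> 'a \<Rightarrow> bool) \<Rightarrow> bool" where
  "k_connected k V E \<longleftrightarrow> card V > k \<and>
     (\<forall>S. S \<subseteq> V \<and> card S < k \<longrightarrow> connected_on (V - S) E)"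

definition has_induced :: "'b set \<Rightarrow> ('b \<Rightarrow> 'b \<Rightarrow> bool) \<Rightarrow> 'a set \<Rightarrow> ('a \<Rightarrow> 'a \<Rightarrow> bool) \<Rightarrow> bool" where
  "has_induced VR ER V E \<longleftrightarrow> (\<exists>f. inj_on f VR \<and> f ` VR \<subseteq> V \<and>
     (\<forall>x\<in>VR. \<forall>y\<in>VR. ER x y \<longleftrightarrow> E (f x) (f y)))"

definition R_free :: "'b set \<Rightarrow> ('b \<Rightarrow> 'b \<Rightarrow> bool) \<Rightarrow> 'a set \<Rightarrow> ('a \<Rightarrow> 'a \<Rightarrow> bool) \<Rightarrow> bool" where
  "R_free VR ER V E \<longleftrightarrow> \<not> has_induced VR ER V E"

definition K2_kK1_V :: "nat \<Rightarrow> nat set" where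
  "K2_kK1_V k = {0..<k+2}"

definition K2_kK1_E :: "nat \<Rightarrow> nat \<Rightarrow> bool" where
  "K2_kK1_E x y \<longleftrightarrow> (x = 0 \<and> y = 1) \<or> (x = 1 \<and> y = 0)"

definition hamiltonian :: "'a set \<Rightarrow> ('a \<Rightarrow> 'a \<Rightarrow> bool) \<Rightarrow> bool" where
  "hamiltonian V E \<longleftrightarrow> (\<exists>vs. distinct vs \<and> set vs = V \<and> length vs \<ge> 3 \<and>
     (\<forall>i < length vs. E (vs ! i) (vs ! ((i + 1) mod length vs))))"

text \<open>Petersen graph on {0..9}: outer 5-cycle, spokes, inner pentagram.\<close>
definition petersen_V :: "nat set" where
  "petersen_V = {0..<10}"

definition petersen_E0 :: "nat \<Rightarrow> nat \<Rightarrow> bool" where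
  "petersen_E0 x y \<longleftrightarrow>
     (x < 5 \<and> y < 5 \<and> y = (x + 1) mod 5) \<or>
     (x < 5 \<and> y = x + 5) \<or>
     (5 \<le> x \<and> x < 10 \<and> 5 \<le> y \<and> y < 10 \<and> y - 5 = (x - 5 + 2) mod 5)"

definition petersen_E :: "nat \<Rightarrow> nat \<Rightarrow> bool" where
  "petersen_E x y \<longleftrightarrow> petersen_E0 x y \<or> petersen_E0 y x"

definition graph_iso :: "'b set \<Rightarrow> ('b \<Rightarrow> 'b \<Rightarrow> bool) \<Rightarrow> 'a set \<Rightarrow> ('a \<Rightarrow> 'a \<Rightarrow> bool) \<Rightarrow> bool" where
  "graph_iso V1 E1 V2 E2 \<longleftrightarrow> (\<exists>f. bij_betw f V1 V2 \<and>
     (\<forall>x\<in>V1. \<forall>y\<in>V1. E1 x y \<longleftrightarrow> E2 (f x) (f y)))"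

definition is_petersen :: "'a set \<Rightarrow> ('a \<Rightarrow> 'a \<Rightarrow> bool) \<Rightarrow> bool" where
  "is_petersen V E \<longleftrightarrow> graph_iso petersen_V petersen_E V E"

end

theory Submission
  imports Defs
begin

text \<open>
Let C be a longest cycle of a non-hamiltonian graph as in the theorem. By k-connectivity every
component of G - C has at least k neighbours on C, whose successors are independent; hence a
component with an edge would yield an induced K2 + kK1, and V - C is independent. Fix v outside C,
let d be its degree, and let A and B be the sets of successors and of predecessors of N(v) on C;
both stay independent after adding v. Throughout, a vertex with a neighbour in an independent set
misses at most k - 1 of its elements.

If there is no edge between A and B, then I = A + B + v is independent. The vertices without a
neighbour in I are again independent, so by the bound on the independence number there are two
consecutive vertices y, z of C that both have neighbours in I. Ordering C from z to y, the
B-neighbours of y, the A-neighbours of z and the A-neighbours of y occur in this order (up to common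
end points), and each set has at least d - k + 2 elements; this contradicts 2d >= 3(k - 1).

If the predecessor of some x in N(v) has A-neighbours, then x misses the two cycle neighbours of all
but the last of the corresponding vertices of N(v), and also the remaining A-neighbour, because the
uncovered vertex can be moved to it. If moreover the successor of x has B-neighbours, then x misses
too many vertices of A, unless k = d = 3. Otherwise the missed predecessors can be added to A + v
without losing independence, and x misses too many vertices of the larger set.

In the exceptional case all A-B pairs around different neighbours of v are adjacent, and every vertex
of A and B has degree 3 because it is left out by some longest cycle; this forces the Petersen graph.
\<close>

section \<open>Arcs of a cyclic list\<close>

definition is_cycle :: "('a \<Rightarrow> 'a \<Rightarrow> bool) \<Rightarrow> 'a list \<Rightarrow> bool" where
  "is_cycle E c \<longleftrightarrow> distinct c \<and> 3 \<le> length c \<and> successively E c \<and> E (last c) (hd c)"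

text \<open>The oriented edges do not depend on where the list starts, and reversing the list takes
  the converse. Facts about successors on \<open>rev c\<close> are therefore facts about
  predecessors on \<open>c\<close>.\<close>

definition arcs :: "'a list \<Rightarrow> ('a \<times> 'a) set" where
  "arcs c = set (zip c (tl c)) \<union> (if c = [] then {} else {(last c, hd c)})"

definition succs :: "'a list \<Rightarrow> 'a set \<Rightarrow> 'a set" where
  "succs c N = {b. \<exists>a\<in>N. (a, b) \<in> arcs c}"

lemma set_zip_tl_append:
  "set (zip (p @ q) (tl (p @ q))) =
   set (zip p (tl p)) \<union> set (zip q (tl q)) \<union> (if p = [] \<or> q = [] then {} else {(last p, hd q)})"
proof (induction p)
  case (Cons x p)
  then show ?case by (cases p; cases q) auto
qed auto

lemma arcs_append_commute: "arcs (q @ p) = arcs (p @ q)"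
  by (auto simp: arcs_def set_zip_tl_append)

lemma set_zip_tl_rev: "set (zip (rev c) (tl (rev c))) = (set (zip c (tl c)))\<inverse>"
proof (induction c)
  case (Cons x c)
  then show ?case
    using set_zip_tl_append[of "rev c" "[x]"] set_zip_tl_append[of "[x]" c] by (auto simp: last_rev)
qed auto

lemma arcs_rev: "arcs (rev c) = (arcs c)\<inverse>"
  by (auto simp: arcs_def set_zip_tl_rev last_rev hd_rev)

lemma arcs_iff:
  "(a, b) \<in> arcs c \<longleftrightarrow>
   (\<exists>i. Suc i < length c \<and> a = c ! i \<and> b = c ! Suc i) \<or> (c \<noteq> [] \<and> a = last c \<and> b = hd c)"
proof -
  have "(a, b) \<in> set (zip c (tl c)) \<longleftrightarrow> (\<exists>i. Suc i < length c \<and> a = c ! i \<and> b = c ! Suc i)"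
    by (force simp: in_set_zip nth_tl)
  then show ?thesis by (auto simp: arcs_def)
qed

lemma arcs_subset: "arcs c \<subseteq> set c \<times> set c"
  by (auto simp: arcs_iff)

lemma arcs_pred_unique:
  assumes "distinct c" "(a, x) \<in> arcs c" "(b, x) \<in> arcs c" shows "a = b"
proof -
  have *: "c ! i \<noteq> hd c" if "0 < i" "i < length c" for i
    using that assms(1) by (cases c) (auto simp: nth_eq_iff_index_eq hd_conv_nth)
  show ?thesis
    using assms(2,3) *[of "Suc _"] assms(1) unfolding arcs_iff
    by (auto simp: nth_eq_iff_index_eq) (metis zero_less_Suc)+
qed

lemma arcs_succ_unique:
  assumes "distinct c" "(x, a) \<in> arcs c" "(x, b) \<in> arcs c" shows "a = b"
  using arcs_pred_unique[of "rev c" a x b] assms by (auto simp: arcs_rev)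

lemma arcs_succ_ex: "a \<in> set c \<Longrightarrow> \<exists>b. (a, b) \<in> arcs c"
proof -
  assume "a \<in> set c"
  then obtain i where i: "i < length c" "a = c ! i" by (auto simp: in_set_conv_nth)
  then have "Suc i < length c \<or> c ! i = last c"
    by (metis Suc_lessI diff_Suc_1 last_conv_nth list.size(3) not_less_zero)
  then show ?thesis using i unfolding arcs_iff by fastforce
qed

lemma arcs_pred_ex: "b \<in> set c \<Longrightarrow> \<exists>a. (a, b) \<in> arcs c"
  using arcs_succ_ex[of b "rev c"] by (auto simp: arcs_rev)

lemma is_cycle_append_commute: "is_cycle E (p @ q) \<Longrightarrow> is_cycle E (q @ p)"
  by (auto simp: is_cycle_def successively_append_iff hd_append last_append split: if_splits)

lemma card_succs:
  assumes "distinct c" "N \<subseteq> set c"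
  shows "card (succs c N) = card N"
proof -
  define f where "f a = (SOME b. (a, b) \<in> arcs c)" for a
  have f: "(a, f a) \<in> arcs c" if "a \<in> N" for a
    unfolding f_def using arcs_succ_ex[of a c] that assms(2) by (metis someI_ex subsetD)
  have "succs c N = f ` N"
    unfolding succs_def using f arcs_succ_unique[OF assms(1)] by blast
  moreover have "inj_on f N"
    by (intro inj_onI) (metis f arcs_pred_unique[OF assms(1)])
  ultimately show ?thesis by (simp add: card_image)
qed

lemma succs_subset: "succs c N \<subseteq> set c"
  using arcs_subset by (force simp: succs_def)

text \<open>Lets any chosen arc become the closing arc from \<open>last\<close> to
  \<open>hd\<close>, so that later index arguments avoid wrap-around.\<close>

lemma cycle_rotate_to:
  assumes "is_cycle E c" "(y, x) \<in> arcs c"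
  obtains c' where "is_cycle E c'" "set c' = set c" "length c' = length c" "arcs c' = arcs c"
    "arcs (rev c') = arcs (rev c)" "hd c' = x" "last c' = y"
proof -
  have "x \<in> set c" using assms(2) arcs_subset by blast
  then obtain p q where c: "c = p @ x # q" by (auto simp: in_set_conv_decomp)
  let ?c = "(x # q) @ p"
  have *: "is_cycle E ?c" using assms(1) is_cycle_append_commute[of E p "x # q"] c by simp
  have **: "arcs ?c = arcs c" using arcs_append_commute[of "x # q" p] c by simp
  have "(last ?c, x) \<in> arcs ?c" unfolding arcs_iff by (intro disjI2) simp
  then have "last ?c = y"
    using ** assms(2) arcs_pred_unique[of ?c] * by (metis is_cycle_def)
  then show thesis
    using that[of ?c] * ** c arcs_rev[of ?c] arcs_rev[of c] by (simp add: Un_commute Un_left_commute add.commute)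
qed

text \<open>The three segments are the pieces that the exchange arguments below reverse or permute;
  \<open>i\<close> and \<open>j\<close> are the positions where the second and the third
  begin.\<close>

lemma split3:
  assumes "0 < i" "i < j" "j < length c"
  obtains p q r where "c = p @ q @ r" "p \<noteq> []" "q \<noteq> []" "r \<noteq> []" "hd p = c ! 0"
    "last p = c ! (i - 1)" "hd q = c ! i" "last q = c ! (j - 1)" "hd r = c ! j" "last r = last c"
    "length p = i" "length (p @ q) = j"
proof -
  let ?p = "take i c" and ?q = "take (j - i) (drop i c)" and ?r = "drop j c"
  have "c = ?p @ ?q @ ?r"
    using assms by (metis append_take_drop_id drop_drop le_add_diff_inverse2 less_imp_le)
  moreover have "?p \<noteq> []" "?q \<noteq> []" "?r \<noteq> []" "last ?r = last c"
    "length ?p = i" "length (?p @ ?q) = j" using assms by auto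
  moreover have "hd ?p = c ! 0" "last ?p = c ! (i - 1)" "hd ?q = c ! i" "last ?q = c ! (j - 1)"
    "hd ?r = c ! j"
    using assms calculation(2,3) by (simp_all add: hd_drop_conv_nth last_conv_nth hd_conv_nth)
  ultimately show thesis using that by blast
qed

lemma succs_index:
  assumes "c \<noteq> []" "last c \<notin> N"
  shows "succs c N = {c ! Suc i | i. Suc i < length c \<and> c ! i \<in> N}"
  using assms unfolding succs_def arcs_iff by auto

lemma succs_rev_index:
  assumes "c \<noteq> []"
  shows "succs (rev c) N = {c ! i | i. Suc i < length c \<and> c ! Suc i \<in> N} \<union> (if hd c \<in> N then {last c} else {})"
  using assms unfolding succs_def arcs_rev converse_iff arcs_iff by auto

section \<open>Connectivity and forbidden subgraphs\<close>

lemma rtranclp_path: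
  assumes "(\<lambda>x y. x \<in> W \<and> y \<in> W \<and> E x y)\<^sup>*\<^sup>* u v" "u \<in> W"
  shows "\<exists>p. p \<noteq> [] \<and> hd p = u \<and> last p = v \<and> distinct p \<and> successively E p \<and> set p \<subseteq> W"
  using assms(1)
proof (induction rule: rtranclp_induct)
  case base
  show ?case using assms(2) by (intro exI[of _ "[u]"]) auto
next
  case (step y z)
  then obtain p where p: "p \<noteq> []" "hd p = u" "last p = y" "distinct p" "successively E p" "set p \<subseteq> W" by blast
  show ?case
  proof (cases "z \<in> set p")
    case True
    \<comment> \<open>If \<open>z\<close> already lies on the path, the path is cut there and stays
      distinct.\<close>
    then obtain q r where "p = q @ z # r" by (auto simp: in_set_conv_decomp)
    then show ?thesis using p
      by (intro exI[of _ "q @ [z]"]) (auto simp: successively_append_iff hd_append)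
  next
    case False
    then show ?thesis using p step(2)
      by (intro exI[of _ "p @ [z]"]) (auto simp: successively_append_iff)
  qed
qed

text \<open>Otherwise \<open>p\<close>, \<open>q\<close> and \<open>k\<close> elements of
  \<open>S\<close> induce the forbidden graph. Both \<open>p\<close> and \<open>q\<close> lie
  outside \<open>S\<close>, because they are adjacent to each other while \<open>S\<close> avoids
  the neighbours of both.\<close>

lemma K2_kK1_free_card:
  assumes graph: "simple_graph V E" and free: "R_free (K2_kK1_V k) K2_kK1_E V E"
    and pq: "E p q" and S: "S \<subseteq> V" "\<forall>x\<in>S. \<forall>y\<in>S. \<not> E x y" "\<forall>s\<in>S. \<not> E p s \<and> \<not> E q s"
  shows "card S < k"
proof (rule ccontr)
  assume "\<not> card S < k"
  then obtain T where T: "T \<subseteq> S" "card T = k" "finite T"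
    by (metis obtain_subset_with_card_n not_less)
  obtain f where f: "bij_betw f {0..<k} T" using ex_bij_betw_nat_finite[OF T(3)] T(2) by blast
  have sym: "\<And>x y. E x y \<Longrightarrow> E y x" and irr: "\<And>x. \<not> E x x" and inV: "p \<in> V" "q \<in> V"
    using graph pq by (auto simp: simple_graph_def)
  have fT: "f i \<in> T" if "i < k" for i using f that by (auto simp: bij_betw_def)
  have f_inj: "f i = f j \<longleftrightarrow> i = j" if "i < k" "j < k" for i j
    using f that by (auto simp: bij_betw_def inj_on_def)
  have ne: "f i \<noteq> p" "f i \<noteq> q" if "i < k" for i
    using fT[OF that] T(1) S(3) pq sym by blast+
  then have ne': "p \<noteq> f i" "q \<noteq> f i" if "i < k" for i
    using that by metis+
  have nE: "\<not> E p (f i)" "\<not> E q (f i)" "\<not> E (f i) p" "\<not> E (f i) q" if "i < k" for i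
    using fT[OF that] T(1) S(3) sym by blast+
  have nf: "\<not> E (f i) (f j)" if "i < k" "j < k" for i j
    using fT[OF that(1)] fT[OF that(2)] T(1) S(2) by blast
  have pq': "p \<noteq> q" using pq irr by blast
  define F where "F i = (if i = 0 then p else if i = 1 then q else f (i - 2))" for i :: nat
  have F: "F 0 = p" "F (Suc 0) = q" "\<And>i. F (Suc (Suc i)) = f i" by (auto simp: F_def)
  have split: "i = 0 \<or> i = Suc 0 \<or> (\<exists>m<k. i = Suc (Suc m))" if "i \<in> K2_kK1_V k" for i
    using that by (cases i; cases "i - 1") (auto simp: K2_kK1_V_def)
  have "has_induced (K2_kK1_V k) K2_kK1_E V E"
    unfolding has_induced_def
  proof (intro exI[of _ F] conjI ballI)
    show "inj_on F (K2_kK1_V k)"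
    proof (rule inj_onI)
      fix i j assume "i \<in> K2_kK1_V k" "j \<in> K2_kK1_V k" "F i = F j"
      then show "i = j" using split[of i] split[of j] ne ne' pq' by (auto simp: F f_inj)
    qed
    show "F ` K2_kK1_V k \<subseteq> V"
    proof
      fix y assume "y \<in> F ` K2_kK1_V k"
      then obtain i where "i \<in> K2_kK1_V k" "y = F i" by blast
      then show "y \<in> V" using split[of i] fT T(1) S(1) inV by (auto simp: F subset_iff)
    qed
    fix i j assume "i \<in> K2_kK1_V k" "j \<in> K2_kK1_V k"
    then show "K2_kK1_E i j \<longleftrightarrow> E (F i) (F j)"
      using split[of i] split[of j] nE nf pq sym[OF pq] irr by (auto simp: F K2_kK1_E_def)
  qed
  then show False using free by (simp add: R_free_def)
qed

text \<open>Deleting a smaller neighbourhood would isolate \<open>x\<close>, while more than one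
  vertex remains.\<close>

lemma k_connected_degree:
  assumes graph: "simple_graph V E" and conn: "k_connected k V E" and x: "x \<in> V"
  shows "k \<le> card {y. E x y}"
proof (rule ccontr)
  let ?N = "{y. E x y}"
  assume k: "\<not> k \<le> card ?N"
  have N: "?N \<subseteq> V" "finite V" "\<not> E x x" using graph by (auto simp: simple_graph_def)
  have c: "connected_on (V - ?N) E" "k < card V" using conn k N(1) by (auto simp: k_connected_def)
  have "card (V - ?N) = card V - card ?N" using N by (meson card_Diff_subset finite_subset)
  then have "1 < card (V - ?N)" using c(2) k by linarith
  then have "\<not> V - ?N \<subseteq> {x}" using card_mono[of "{x}" "V - ?N"] by auto
  then obtain z where z: "z \<in> V - ?N" "z \<noteq> x" by blast
  have "(\<lambda>a b. a \<in> V - ?N \<and> b \<in> V - ?N \<and> E a b)\<^sup>*\<^sup>* x z"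
    using c(1) z(1) x N(3) unfolding connected_on_def by blast
  then show False using z(2) by (cases rule: converse_rtranclpE) auto
qed

text \<open>Two neighbours of a vertex \<open>x\<close> are joined by a path avoiding
  \<open>x\<close>, which closes up through \<open>x\<close>.\<close>

lemma k_connected_ex_cycle:
  assumes graph: "simple_graph V E" and conn: "k_connected k V E" and k: "2 \<le> k"
  shows "\<exists>c. is_cycle E c"
proof -
  have "V \<noteq> {}" using conn k by (auto simp: k_connected_def)
  then obtain x where x: "x \<in> V" by blast
  have deg: "2 \<le> card {y. E x y}" using k_connected_degree[OF graph conn x] k by simp
  have "{y. E x y} \<noteq> {}" using deg by (metis card.empty not_numeral_le_zero)
  then obtain y where y: "E x y" by blast
  have "\<not> {y. E x y} \<subseteq> {y}" using deg card_mono[of "{y}" "{y. E x y}"] by auto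
  then obtain z where z: "E x z" "z \<noteq> y" by blast
  have g: "y \<in> V - {x}" "z \<in> V - {x}" "E z x" using graph y z by (auto simp: simple_graph_def)
  have "card {x} < k" using k by simp
  then have "connected_on (V - {x}) E"
    using conn x unfolding k_connected_def by blast
  then have "(\<lambda>a b. a \<in> V - {x} \<and> b \<in> V - {x} \<and> E a b)\<^sup>*\<^sup>* y z" using g by (simp add: connected_on_def)
  then obtain p where p: "p \<noteq> []" "hd p = y" "last p = z" "distinct p" "successively E p" "set p \<subseteq> V - {x}"
    using rtranclp_path[of "V - {x}" E y z] g(1) by blast
  have "2 \<le> length p" using p(1-3) z(2) by (cases p; cases "tl p") auto
  then have "is_cycle E (x # p)" using p y g(3) by (auto simp: is_cycle_def successively_Cons)
  then show ?thesis by blast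
qed

text \<open>By antisymmetry at most one element is common to both sets. This serves for index sets
  that follow each other along a cycle.\<close>

lemma card_ordered_pair:
  fixes X Y :: "nat set"
  assumes "finite X" "finite Y" "\<And>x y. x \<in> X \<Longrightarrow> y \<in> Y \<Longrightarrow> x \<le> y"
  shows "card X + card Y \<le> Suc (card (X \<union> Y))"
proof -
  have "card (X \<inter> Y) \<le> 1"
    using assms by (intro card_le_Suc0_iff_eq[THEN iffD2, unfolded One_nat_def[symmetric]]) (auto intro: antisym)
  then show ?thesis using card_Un_Int[OF assms(1,2)] by simp
qed

lemma petersen_adjacency:
  assumes "j < 10"
  shows "petersen_E 0 j \<longleftrightarrow> j = 1 \<or> j = 4 \<or> j = 5" "petersen_E 1 j \<longleftrightarrow> j = 0 \<or> j = 2 \<or> j = 6"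
    "petersen_E 2 j \<longleftrightarrow> j = 1 \<or> j = 3 \<or> j = 7" "petersen_E 3 j \<longleftrightarrow> j = 4 \<or> j = 2 \<or> j = 8"
    "petersen_E 4 j \<longleftrightarrow> j = 0 \<or> j = 9 \<or> j = 3" "petersen_E 5 j \<longleftrightarrow> j = 0 \<or> j = 8 \<or> j = 7"
    "petersen_E 6 j \<longleftrightarrow> j = 1 \<or> j = 9 \<or> j = 8" "petersen_E 7 j \<longleftrightarrow> j = 5 \<or> j = 2 \<or> j = 9"
    "petersen_E 8 j \<longleftrightarrow> j = 5 \<or> j = 6 \<or> j = 3" "petersen_E 9 j \<longleftrightarrow> j = 4 \<or> j = 6 \<or> j = 7"
proof -
  have "j \<in> {0, 1, 2, 3, 4, 5, 6, 7, 8, 9}" using assms by auto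
  then show "petersen_E 0 j \<longleftrightarrow> j = 1 \<or> j = 4 \<or> j = 5" "petersen_E 1 j \<longleftrightarrow> j = 0 \<or> j = 2 \<or> j = 6"
    "petersen_E 2 j \<longleftrightarrow> j = 1 \<or> j = 3 \<or> j = 7" "petersen_E 3 j \<longleftrightarrow> j = 4 \<or> j = 2 \<or> j = 8"
    "petersen_E 4 j \<longleftrightarrow> j = 0 \<or> j = 9 \<or> j = 3" "petersen_E 5 j \<longleftrightarrow> j = 0 \<or> j = 8 \<or> j = 7"
    "petersen_E 6 j \<longleftrightarrow> j = 1 \<or> j = 9 \<or> j = 8" "petersen_E 7 j \<longleftrightarrow> j = 5 \<or> j = 2 \<or> j = 9"
    "petersen_E 8 j \<longleftrightarrow> j = 5 \<or> j = 6 \<or> j = 3" "petersen_E 9 j \<longleftrightarrow> j = 4 \<or> j = 6 \<or> j = 7"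
    unfolding petersen_E_def petersen_E0_def by (elim insertE emptyE; simp)+
qed

section \<open>Longest cycles\<close>

text \<open>\<open>L\<close> only bounds all cycle lengths, and \<open>longest\<close> below means
  attaining it. No cycle is fixed, because later arguments pass from one longest cycle to
  another.\<close>

locale longest_cycle =
  fixes V :: "'a set" and E :: "'a \<Rightarrow> 'a \<Rightarrow> bool" and L :: nat
  assumes graph: "simple_graph V E"
    and cycle_length_le: "is_cycle E c \<Longrightarrow> length c \<le> L"
begin

lemma sym: "E x y \<Longrightarrow> E y x" and irrefl: "\<not> E x x"
  and in_V: "E x y \<Longrightarrow> x \<in> V" "E x y \<Longrightarrow> y \<in> V" and fin: "finite V"
  using graph by (auto simp: simple_graph_def)

lemma sym_iff: "E x y \<longleftrightarrow> E y x"
  using sym by blast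

lemma successively_flip: "successively (\<lambda>x y. E y x) xs = successively E xs"
  using sym_iff by presburger

definition longest :: "'a list \<Rightarrow> bool" where
  "longest c \<longleftrightarrow> is_cycle E c \<and> length c = L"

lemma longest_rev: "longest c \<Longrightarrow> longest (rev c)"
  using sym_iff[of "last c" "hd c"]
  by (auto simp: longest_def is_cycle_def successively_flip hd_rev last_rev)

lemma longest_subset: "longest c \<Longrightarrow> set c \<subseteq> V"
proof
  fix x assume c: "longest c" "x \<in> set c"
  then obtain b where b: "(x, b) \<in> arcs c" using arcs_succ_ex by metis
  have "E x b"
    using b c unfolding arcs_iff longest_def is_cycle_def
    by (auto simp: successively_conv_nth)
  then show "x \<in> V" by (rule in_V)
qed

lemma arcs_adj: "longest c \<Longrightarrow> (x, y) \<in> arcs c \<Longrightarrow> E x y"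
  unfolding arcs_iff longest_def is_cycle_def by (auto simp: successively_conv_nth)

lemma longest_rotate_to:
  assumes "longest c" "(y, x) \<in> arcs c"
  obtains c' where "longest c'" "set c' = set c" "arcs c' = arcs c"
    "arcs (rev c') = arcs (rev c)" "hd c' = x" "last c' = y"
  using assms cycle_rotate_to[of E c y x] unfolding longest_def by metis

section \<open>Exchange arguments: longer cycles from the segments of a cycle\<close>

lemmas cycle_simps = longest_def is_cycle_def successively_append_iff successively_Cons successively_flip
  hd_append last_append hd_rev last_rev

lemma no_insert:
  assumes "longest c" "w \<noteq> []" "distinct w" "successively E w" "set w \<inter> set c = {}"
    and "E (last c) (hd w)" "E (last w) (hd c)"
  shows False
proof -
  have "is_cycle E (c @ w)" using assms by (auto simp: cycle_simps)
  then show False using cycle_length_le[of "c @ w"] assms by (auto simp: longest_def)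
qed

text \<open>The cycle \<open>p @ w @ rev q @ r\<close> would be longer: the detour \<open>w\<close>
  and one chord replace the two arcs between the segments.\<close>

lemma no_cross_path:
  assumes c: "longest c" and w: "w \<noteq> []" "distinct w" "successively E w" "set w \<inter> set c = {}"
    and ij: "0 < i" "i < j" "j < length c"
    and "E (c ! (i - 1)) (hd w)" "E (last w) (c ! (j - 1))" "E (c ! i) (c ! j)"
  shows False
proof -
  obtain p q r where s: "c = p @ q @ r" "p \<noteq> []" "q \<noteq> []" "r \<noteq> []" "hd p = c ! 0"
    "last p = c ! (i - 1)" "hd q = c ! i" "last q = c ! (j - 1)" "hd r = c ! j" "last r = last c"
    "length p = i" "length (p @ q) = j"
    using split3[OF ij] .
  have "E (last p) (hd w)" "E (last w) (last q)" "E (hd q) (hd r)" unfolding s(5-10) using assms(5-) by blast+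
  then have "is_cycle E (p @ w @ rev q @ r)" using c w s(1-4) by (auto simp: cycle_simps)
  from cycle_length_le[OF this] show False using c w s(1) by (auto simp: longest_def)
qed

text \<open>In \<open>p @ [v] @ rev q @ [u] @ r\<close> a second detour through \<open>u\<close>
  takes the place of the chord.\<close>

lemma no_cross_two:
  assumes c: "longest c" and v: "v \<notin> set c" "u \<notin> set c" "u \<noteq> v"
    and ij: "0 < i" "i < j" "j < length c"
    and "E v (c ! (i - 1))" "E v (c ! (j - 1))" "E u (c ! i)" "E u (c ! j)"
  shows False
proof -
  obtain p q r where s: "c = p @ q @ r" "p \<noteq> []" "q \<noteq> []" "r \<noteq> []" "hd p = c ! 0"
    "last p = c ! (i - 1)" "hd q = c ! i" "last q = c ! (j - 1)" "hd r = c ! j" "last r = last c"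
    "length p = i" "length (p @ q) = j"
    using split3[OF ij] .
  have "E (last p) v" "E v (last q)" "E (hd q) u" "E u (hd r)" unfolding s(5-10) using assms(5-) sym by blast+
  then have "is_cycle E (p @ [v] @ rev q @ [u] @ r)" using c v s(1-4) by (auto simp: cycle_simps)
  from cycle_length_le[OF this] show False using c s(1) by (auto simp: longest_def)
qed

text \<open>Here the closing arc is given up as well: \<open>p @ [v] @ rev q @ rev r\<close> closes
  with the chord from \<open>c ! j\<close> to \<open>c ! 0\<close>.\<close>

lemma no_cross_ends:
  assumes c: "longest c" and v: "v \<notin> set c" and ij: "0 < i" "i < j" "j < length c"
    and "E v (c ! (i - 1))" "E v (c ! (j - 1))" "E (c ! i) (last c)" "E (c ! j) (c ! 0)"
  shows False
proof -
  obtain p q r where s: "c = p @ q @ r" "p \<noteq> []" "q \<noteq> []" "r \<noteq> []" "hd p = c ! 0"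
    "last p = c ! (i - 1)" "hd q = c ! i" "last q = c ! (j - 1)" "hd r = c ! j" "last r = last c"
    "length p = i" "length (p @ q) = j"
    using split3[OF ij] .
  have "E (last p) v" "E v (last q)" "E (hd q) (last r)" "E (hd r) (hd p)" unfolding s(5-10) using assms(5-) sym by blast+
  then have "is_cycle E (p @ [v] @ rev q @ rev r)" using c v s(1-4) by (auto simp: cycle_simps)
  from cycle_length_le[OF this] show False using c s(1) by (auto simp: longest_def)
qed

text \<open>The last two segments are swapped and the middle one is reversed, giving the longer
  cycle \<open>p @ [v] @ r @ rev q\<close>.\<close>

lemma no_cross_ends_rev:
  assumes c: "longest c" and v: "v \<notin> set c" and ij: "0 < i" "i < j" "j < length c"
    and "E v (c ! (i - 1))" "E v (c ! j)" "E (c ! (j - 1)) (last c)" "E (c ! i) (c ! 0)"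
  shows False
proof -
  obtain p q r where s: "c = p @ q @ r" "p \<noteq> []" "q \<noteq> []" "r \<noteq> []" "hd p = c ! 0"
    "last p = c ! (i - 1)" "hd q = c ! i" "last q = c ! (j - 1)" "hd r = c ! j" "last r = last c"
    "length p = i" "length (p @ q) = j"
    using split3[OF ij] .
  have "E (last p) v" "E v (hd r)" "E (last r) (last q)" "E (hd q) (hd p)" unfolding s(5-10) using assms(5-) sym by blast+
  then have "is_cycle E (p @ [v] @ r @ rev q)" using c v s(1-4) by (auto simp: cycle_simps)
  from cycle_length_le[OF this] show False using c s(1) by (auto simp: longest_def)
qed

text \<open>Swapping the last two segments without any reversal gives the longer cycle
  \<open>p @ [v] @ r @ q\<close>.\<close>

lemma no_cross_shift:
  assumes c: "longest c" and v: "v \<notin> set c" and ij: "0 < i" "i < j" "j < length c"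
    and "E v (c ! (i - 1))" "E v (c ! j)" "E (c ! i) (last c)" "E (c ! (j - 1)) (c ! 0)"
  shows False
proof -
  obtain p q r where s: "c = p @ q @ r" "p \<noteq> []" "q \<noteq> []" "r \<noteq> []" "hd p = c ! 0"
    "last p = c ! (i - 1)" "hd q = c ! i" "last q = c ! (j - 1)" "hd r = c ! j" "last r = last c"
    "length p = i" "length (p @ q) = j"
    using split3[OF ij] .
  have "E (last p) v" "E v (hd r)" "E (last r) (hd q)" "E (last q) (hd p)" unfolding s(5-10) using assms(5-) sym by blast+
  then have "is_cycle E (p @ [v] @ r @ q)" using c v s(1-4) by (auto simp: cycle_simps)
  from cycle_length_le[OF this] show False using c s(1) by (auto simp: longest_def)
qed

text \<open>The vertex \<open>v\<close> takes the place of \<open>c ! Suc g\<close>: the stretch up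
  to the later of the two neighbours of \<open>v\<close> is reversed, and the chord from
  \<open>c ! Suc (Suc g)\<close> to \<open>c ! Suc i\<close> bridges the gap. The ends of the list
  stay, so the closing arc survives.\<close>

lemma reroute:
  assumes c: "longest c" and v: "v \<notin> set c"
    and ig: "Suc i < length c" "Suc (Suc g) < length c" "i \<noteq> g" "i \<noteq> Suc g"
    and adj: "E v (c ! g)" "E v (c ! i)" "E (c ! Suc (Suc g)) (c ! Suc i)"
  shows "\<exists>c'. longest c' \<and> c ! Suc g \<notin> set c' \<and> hd c' = hd c \<and> last c' = last c"
proof -
  define a where "a = c ! Suc g"
  have dist: "distinct c" using c by (simp add: longest_def is_cycle_def)
  have a_in: "a \<in> set c" using ig unfolding a_def by simp
  have "\<exists>c'. longest c' \<and> a \<notin> set c' \<and> hd c' = hd c \<and> last c' = last c"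
  \<comment> \<open>The dropped vertex heads the third segment if \<open>i < g\<close>, and the
    second one otherwise.\<close>
  proof (cases "i < g")
    case True
    obtain p q r where s: "c = p @ q @ r" "p \<noteq> []" "q \<noteq> []" "r \<noteq> []" "hd p = c ! 0"
      "last p = c ! (Suc i - 1)" "hd q = c ! Suc i" "last q = c ! (Suc g - 1)" "hd r = c ! Suc g" "last r = last c"
      "length p = Suc i" "length (p @ q) = Suc g"
      using split3[of "Suc i" "Suc g" c] True ig by auto
    have "r ! 1 = c ! Suc (Suc g)"
      using s(1,12) nth_append_length_plus[of "p @ q" r 1] by simp
    moreover have "1 < length r" using s(1,12) ig(2) by auto
    ultimately obtain r' where r: "r = a # r'" "r' \<noteq> []" "hd r' = c ! Suc (Suc g)"
      using s(9)[folded a_def] by (cases r) (auto simp: hd_conv_nth)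
    have "E (last p) v" "E v (last q)" "E (hd q) (hd r')" using s(6-8) r(3) adj sym by (metis diff_Suc_1)+
    then have "is_cycle E (p @ [v] @ rev q @ r')"
      using c v s(1-4) r(1,2) by (auto simp: cycle_simps)
    moreover have "a \<notin> set (p @ [v] @ rev q @ r')"
      using s(1) r(1) v a_in dist by auto
    moreover have "hd (p @ [v] @ rev q @ r') = hd c" "last (p @ [v] @ rev q @ r') = last c"
      "length (p @ [v] @ rev q @ r') = length c"
      using s(1-4) r(1,2) by simp_all
    ultimately show ?thesis using c unfolding longest_def by metis
  next
    case False
    then have "Suc g < i" using ig by auto
    obtain p q r where s: "c = p @ q @ r" "p \<noteq> []" "q \<noteq> []" "r \<noteq> []" "hd p = c ! 0"
      "last p = c ! (Suc g - 1)" "hd q = c ! Suc g" "last q = c ! (Suc i - 1)" "hd r = c ! Suc i" "last r = last c"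
      "length p = Suc g" "length (p @ q) = Suc i"
      using split3[of "Suc g" "Suc i" c] \<open>Suc g < i\<close> ig by auto
    have "1 < length q" using s(11,12) \<open>Suc g < i\<close> by auto
    moreover from this have "q ! 1 = c ! Suc (Suc g)"
      using s(1,11) nth_append_length_plus[of p "q @ r" 1] by (simp add: nth_append)
    ultimately obtain q' where q: "q = a # q'" "q' \<noteq> []" "hd q' = c ! Suc (Suc g)"
      using s(7)[folded a_def] by (cases q) (auto simp: hd_conv_nth)
    have "last q' = last q" using q by simp
    then have "E (last p) v" "E v (last q')" "E (hd q') (hd r)"
      using s(6,8,9) q(3) adj sym by (metis diff_Suc_1)+
    then have "is_cycle E (p @ [v] @ rev q' @ r)"
      using c v s(1-4) q(1,2) by (auto simp: cycle_simps)
    moreover have "a \<notin> set (p @ [v] @ rev q' @ r)"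
      using s(1) q(1) v a_in dist by auto
    moreover have "hd (p @ [v] @ rev q' @ r) = hd c" "last (p @ [v] @ rev q' @ r) = last c"
      "length (p @ [v] @ rev q' @ r) = length c"
      using s(1-4) q(1,2) by simp_all
    ultimately show ?thesis using c unfolding longest_def by metis
  qed
  then show ?thesis by (simp add: a_def)
qed

text \<open>A common form for the neighbours on \<open>c\<close> of a whole component outside
  \<open>c\<close> and of a single uncovered vertex.\<close>

definition linked :: "'a list \<Rightarrow> 'a set \<Rightarrow> bool" where
  "linked c N \<longleftrightarrow> N \<subseteq> set c \<and> (\<forall>a\<in>N. \<forall>b\<in>N. \<exists>w. w \<noteq> [] \<and> distinct w \<and> successively E w \<and>
     set w \<inter> set c = {} \<and> E a (hd w) \<and> E (last w) b)"

lemma linked_no_consecutive: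
  assumes "longest c" "linked c N" "(a, b) \<in> arcs c" "a \<in> N"
  shows "b \<notin> N"
proof
  assume "b \<in> N"
  obtain c' where c': "longest c'" "set c' = set c" "hd c' = b" "last c' = a"
    using longest_rotate_to[OF assms(1,3)] .
  show False
    using assms(2,4) \<open>b \<in> N\<close> no_insert[OF c'(1)] c'(2-4) unfolding linked_def by metis
qed

text \<open>With \<open>x\<close> in first position, an edge \<open>a b\<close> and the detour from
  \<open>x\<close> to the predecessor of \<open>b\<close> form the crossing excluded by
  \<open>no_cross_path\<close>.\<close>

lemma linked_succs_independent:
  assumes c: "longest c" and N: "linked c N" and ab: "a \<in> succs c N" "b \<in> succs c N"
  shows "\<not> E a b"
proof
  assume E: "E a b"
  obtain x where x: "x \<in> N" "(x, a) \<in> arcs c" using ab(1) by (auto simp: succs_def)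
  then obtain y where "(y, x) \<in> arcs c" using N arcs_pred_ex[of x c] by (auto simp: linked_def)
  then obtain c' where c': "longest c'" "set c' = set c" "arcs c' = arcs c" "hd c' = x" "last c' = y"
    using longest_rotate_to[OF c] by metis
  have len: "3 \<le> length c'" "distinct c'" "c' \<noteq> []" using c'(1) by (auto simp: longest_def is_cycle_def)
  have x0: "c' ! 0 = x" using c'(4) len by (simp add: hd_conv_nth)
  have "(c' ! 0, c' ! 1) \<in> arcs c'" using len unfolding arcs_iff by fastforce
  then have a: "a = c' ! 1" using x(2) c'(3) x0 arcs_succ_unique[OF len(2)] by metis
  \<comment> \<open>Hence \<open>b\<close> does not arise from the closing arc and has a positive
    index.\<close>
  have "y \<notin> N"
    using linked_no_consecutive[OF c N \<open>(y, x) \<in> arcs c\<close>] x(1) by blast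
  then have "b \<in> {c' ! Suc i | i. Suc i < length c' \<and> c' ! i \<in> N}"
    using ab(2) succs_index[of c' N] c' len by (auto simp: succs_def)
  then obtain i where i: "Suc i < length c'" "c' ! i \<in> N" "b = c' ! Suc i" by auto
  have "i \<noteq> 0" using E a i(3) irrefl by (metis One_nat_def)
  obtain w where "w \<noteq> []" "distinct w" "successively E w" "set w \<inter> set c' = {}"
    "E x (hd w)" "E (last w) (c' ! i)"
    using N x(1) i(2) c'(2) unfolding linked_def by metis
  then show False
    using no_cross_path[of c' w 1 "Suc i"] c'(1) x0 a i E \<open>i \<noteq> 0\<close> by simp
qed

lemma outside_independent_if_k_connected:
  assumes conn: "k_connected k V E"
    and free: "\<And>p q S. E p q \<Longrightarrow> S \<subseteq> V \<Longrightarrow> \<forall>x\<in>S. \<forall>y\<in>S. \<not> E x y \<Longrightarrow>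
      \<forall>s\<in>S. \<not> E p s \<and> \<not> E q s \<Longrightarrow> card S < k"
    and c: "longest c" and u: "u \<notin> set c" and w: "w \<notin> set c"
  shows "\<not> E u w"
proof
  assume uw: "E u w"
  let ?R = "\<lambda>x y. x \<in> V - set c \<and> y \<in> V - set c \<and> E x y"
  \<comment> \<open>The component of \<open>u\<close> after deletion of \<open>c\<close>.\<close>
  define H where "H = {z. ?R\<^sup>*\<^sup>* u z}"
  have u_in: "u \<in> V - set c" using in_V(1)[OF uw] u by blast
  have sub: "H \<subseteq> V - set c"
  proof
    fix z assume "z \<in> H"
    then have "?R\<^sup>*\<^sup>* u z" by (simp add: H_def)
    then show "z \<in> V - set c" using u_in by (induction rule: rtranclp_induct) auto
  qed
  have step: "y \<in> H" if "x \<in> H" "E x y" "y \<notin> set c" for x y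
    using that sub in_V[OF that(2)] unfolding H_def by (auto intro: rtranclp.rtrancl_into_rtrancl)
  have H: "u \<in> H" "w \<in> H" using step[of u w] uw w by (auto simp: H_def)
  have "symp ?R" using sym by (auto simp: symp_def)
  then have rev: "?R\<^sup>*\<^sup>* y x" if "?R\<^sup>*\<^sup>* x y" for x y
    using that symp_rtranclp sympD by metis
  define N where "N = {x \<in> set c. \<exists>h\<in>H. E x h}"
  have linked: "linked c N"
    unfolding linked_def
  proof (intro conjI ballI)
    show "N \<subseteq> set c" by (auto simp: N_def)
    fix a b assume "a \<in> N" "b \<in> N"
    then obtain h h' where h: "h \<in> H" "E a h" "h' \<in> H" "E b h'" by (auto simp: N_def)
    then have "?R\<^sup>*\<^sup>* h h'" using rev[of u h] by (auto simp: H_def)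
    then obtain p where "p \<noteq> []" "hd p = h" "last p = h'" "distinct p" "successively E p" "set p \<subseteq> V - set c"
      using rtranclp_path[of "V - set c" E h h'] h(1) sub by blast
    then show "\<exists>p. p \<noteq> [] \<and> distinct p \<and> successively E p \<and> set p \<inter> set c = {} \<and> E a (hd p) \<and> E (last p) b"
      using h sym by (intro exI[of _ p]) auto
  qed
  have ne: "c \<noteq> []" "distinct c" using c by (auto simp: longest_def is_cycle_def)
  \<comment> \<open>Such a vertex ensures that deleting \<open>N\<close> really separates something
    from \<open>u\<close>, so that connectivity bounds \<open>card N\<close>.\<close>
  have "\<exists>x\<in>set c. x \<notin> N"
  proof (cases "hd c \<in> N")
    case True
    obtain y where "(hd c, y) \<in> arcs c" using arcs_succ_ex[of "hd c" c] ne by auto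
    then show ?thesis using linked_no_consecutive[OF c linked _ True] arcs_subset[of c] by blast
  qed (use ne in auto)
  then obtain x where x: "x \<in> set c" "x \<notin> N" by blast
  have NV: "N \<subseteq> V" using longest_subset[OF c] by (auto simp: N_def)
  have "k \<le> card N"
  proof (rule ccontr)
    assume "\<not> k \<le> card N"
    then have "connected_on (V - N) E" using conn NV by (auto simp: k_connected_def)
    moreover have "u \<in> V - N" "x \<in> V - N" using u_in x longest_subset[OF c] by (auto simp: N_def)
    ultimately have "(\<lambda>x y. x \<in> V - N \<and> y \<in> V - N \<and> E x y)\<^sup>*\<^sup>* u x" by (auto simp: connected_on_def)
    then have "x \<in> H"
    proof (induction rule: rtranclp_induct)
      case base show ?case by (rule H)
    next
      case (step y z)
      then have "z \<notin> set c" using sym by (auto simp: N_def)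
      then show ?case using step \<open>\<And>y x. x \<in> H \<Longrightarrow> E x y \<Longrightarrow> y \<notin> set c \<Longrightarrow> y \<in> H\<close> by blast
    qed
    then show False using sub x by blast
  qed
  moreover have "card (succs c N) = card N" using card_succs[OF ne(2)] by (simp add: N_def)
  moreover have "card (succs c N) < k"
  proof (rule free[OF uw])
    show "succs c N \<subseteq> V" using succs_subset[of c N] longest_subset[OF c] by blast
    show "\<forall>x\<in>succs c N. \<forall>y\<in>succs c N. \<not> E x y" using linked_succs_independent[OF c linked] by blast
    \<comment> \<open>Successors of \<open>N\<close> lie on \<open>c\<close> but not in
      \<open>N\<close>, so they have no neighbour in \<open>H\<close>, and \<open>H\<close> contains
      both ends of the edge.\<close>
    have "s \<notin> N" "s \<in> set c" if "s \<in> succs c N" for s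
      using that linked_no_consecutive[OF c linked] succs_subset[of c N] by (auto simp: succs_def)
    then show "\<forall>s\<in>succs c N. \<not> E u s \<and> \<not> E w s" using H sym unfolding N_def by blast
  qed
  ultimately show False by simp
qed

end

section \<open>A vertex outside a longest cycle\<close>

text \<open>For a longest cycle c avoiding v, the sets A and B above are succs c (nb v) and
  succs (rev c) (nb v).\<close>

locale edge_sparse_graph = longest_cycle V E L for V :: "'a set" and E L +
  fixes k :: nat
  assumes k_ge_2: "2 \<le> k"
    and free: "E p q \<Longrightarrow> S \<subseteq> V \<Longrightarrow> \<forall>x\<in>S. \<forall>y\<in>S. \<not> E x y \<Longrightarrow>
      \<forall>s\<in>S. \<not> E p s \<and> \<not> E q s \<Longrightarrow> card S < k"
    and degree_ge_k: "x \<in> V \<Longrightarrow> k \<le> card {y. E x y}"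
    and degree_bound: "x \<in> V \<Longrightarrow> 3 * k \<le> 2 * card {y. E x y} + 3"
    and outside_independent: "longest c \<Longrightarrow> u \<notin> set c \<Longrightarrow> w \<notin> set c \<Longrightarrow> \<not> E u w"
    and independent_card: "S \<subseteq> V \<Longrightarrow> \<forall>x\<in>S. \<forall>y\<in>S. \<not> E x y \<Longrightarrow> 2 * card S \<le> card V"
begin

abbreviation nb :: "'a \<Rightarrow> 'a set" where "nb v \<equiv> {y. E v y}"

text \<open>The uncovered vertex is regarded as a hole that exchanges can move to other
  vertices.\<close>

abbreviation hole :: "'a list \<Rightarrow> 'a \<Rightarrow> bool" where
  "hole c v \<equiv> longest c \<and> v \<in> V \<and> v \<notin> set c"

section \<open>Counting neighbours among the successors of N(v)\<close>

lemma finite_subset_V: "S \<subseteq> V \<Longrightarrow> finite S"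
  using fin finite_subset by blast

text \<open>The edge \<open>q p\<close> sees none of the counted vertices: \<open>p\<close> belongs
  to the independent set, and \<open>q\<close> misses them by choice.\<close>

lemma non_neighbours_card:
  assumes "S \<subseteq> V" "\<forall>x\<in>S. \<forall>y\<in>S. \<not> E x y" "p \<in> S" "E q p"
  shows "card {s \<in> S. \<not> E q s} < k"
  using free[of p q "{s \<in> S. \<not> E q s}"] assms sym by blast

lemma hole_rev: "hole c v \<Longrightarrow> hole (rev c) v"
  using longest_rev by simp

lemma nb_subset_hole: "hole c v \<Longrightarrow> nb v \<subseteq> set c"
  using outside_independent by blast

lemma hole_linked:
  assumes "hole c v" shows "linked c (nb v)"
  unfolding linked_def
proof (intro conjI ballI)
  show "nb v \<subseteq> set c" using nb_subset_hole[OF assms] .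
  fix a b assume "a \<in> nb v" "b \<in> nb v"
  then show "\<exists>w. w \<noteq> [] \<and> distinct w \<and> successively E w \<and> set w \<inter> set c = {} \<and> E a (hd w) \<and> E (last w) b"
    using assms sym by (intro exI[of _ "[v]"]) auto
qed

lemma hole_no_consecutive: "hole c v \<Longrightarrow> (a, b) \<in> arcs c \<Longrightarrow> E v a \<Longrightarrow> \<not> E v b"
  using linked_no_consecutive[of c "nb v" a b] hole_linked[of c v] by blast

lemma succs_not_nb: "hole c v \<Longrightarrow> a \<in> succs c (nb v) \<Longrightarrow> \<not> E v a"
  using hole_no_consecutive by (auto simp: succs_def)

lemma succs_independent: "hole c v \<Longrightarrow> a \<in> succs c (nb v) \<Longrightarrow> b \<in> succs c (nb v) \<Longrightarrow> \<not> E a b"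
  using linked_succs_independent hole_linked by blast

lemma insert_succs_independent:
  assumes "hole c v" shows "\<forall>x\<in>insert v (succs c (nb v)). \<forall>y\<in>insert v (succs c (nb v)). \<not> E x y"
  using succs_independent[OF assms] succs_not_nb[OF assms] irrefl sym by blast

lemma succs_subset_V: "hole c v \<Longrightarrow> succs c N \<subseteq> V"
  using succs_subset[of c N] longest_subset[of c] by blast

lemma card_succs_nb: "hole c v \<Longrightarrow> card (succs c (nb v)) = card (nb v)"
  using card_succs[of c "nb v"] nb_subset_hole[of c v] by (auto simp: longest_def is_cycle_def)

text \<open>One of the at most k - 1 missed elements of \<open>S\<close> is \<open>v\<close> itself,
  so at most k - 2 successors are missed. The larger set \<open>S\<close> admits a witness
  \<open>p\<close> that is not a successor.\<close>

lemma succs_neighbours_card_of_superset: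
  assumes h: "hole c v" and q: "\<not> E v q" "p \<in> S" "E q p"
    and S: "insert v (succs c (nb v)) \<subseteq> S" "S \<subseteq> V" "\<forall>x\<in>S. \<forall>y\<in>S. \<not> E x y"
  shows "card (nb v) + 2 \<le> card {a \<in> succs c (nb v). E q a} + k"
proof -
  let ?A = "succs c (nb v)"
  have fA: "finite ?A" using succs_subset_V[OF h] finite_subset_V by blast
  have v: "v \<notin> ?A" using h succs_subset[of c "nb v"] by blast
  have "insert v {a \<in> ?A. \<not> E q a} \<subseteq> {s \<in> S. \<not> E q s}"
    using S(1) q(1) sym by blast
  moreover have "finite {s \<in> S. \<not> E q s}" using finite_subset_V S(2) by (metis (no_types, lifting) finite_subset mem_Collect_eq subsetI)
  ultimately have "card (insert v {a \<in> ?A. \<not> E q a}) < k"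
    using non_neighbours_card[OF S(2,3) q(2,3)] card_mono le_less_trans by metis
  then have 1: "Suc (card {a \<in> ?A. \<not> E q a}) < k" using v fA by simp
  have "?A = {a \<in> ?A. E q a} \<union> {a \<in> ?A. \<not> E q a}" by blast
  then have "card ?A \<le> card {a \<in> ?A. E q a} + card {a \<in> ?A. \<not> E q a}"
    by (metis card_Un_le)
  then show ?thesis using 1 card_succs_nb[OF h] by simp
qed

lemma succs_neighbours_card:
  assumes "hole c v" "\<not> E v q" "p \<in> succs c (nb v)" "E q p"
  shows "card (nb v) + 2 \<le> card {a \<in> succs c (nb v). E q a} + k"
  using succs_neighbours_card_of_superset[of c v q p "insert v (succs c (nb v))"]
    insert_succs_independent[of c v] succs_subset_V[of c v] assms by blast

lemma another_succs_neighbour: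
  assumes "hole c v" "2 \<le> card {a \<in> succs c (nb v). E q a}"
  shows "\<exists>a'\<in>succs c (nb v). a' \<noteq> a \<and> E q a'"
proof (rule ccontr)
  assume "\<not> ?thesis"
  then have "{a \<in> succs c (nb v). E q a} \<subseteq> {a}" by blast
  then have "card {a \<in> succs c (nb v). E q a} \<le> card {a}" by (rule card_mono[rotated]) simp
  then show False using assms(2) by simp
qed

text \<open>Turns counts of successors into counts of positions of N(v), where the order along
  \<open>c\<close> can be used.\<close>

lemma card_succs_filter:
  assumes h: "hole c v" and l: "\<not> E v (last c)"
  shows "card {a \<in> succs c (nb v). P a} = card {i. Suc i < length c \<and> E v (c ! i) \<and> P (c ! Suc i)}"
proof -
  have ne: "c \<noteq> []" "distinct c" using h by (auto simp: longest_def is_cycle_def)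
  have "{a \<in> succs c (nb v). P a} = (\<lambda>i. c ! Suc i) ` {i. Suc i < length c \<and> E v (c ! i) \<and> P (c ! Suc i)}"
    using succs_index[OF ne(1), of "nb v"] l by auto
  moreover have "inj_on (\<lambda>i. c ! Suc i) {i. Suc i < length c \<and> E v (c ! i) \<and> P (c ! Suc i)}"
    using ne(2) by (auto simp: inj_on_def nth_eq_iff_index_eq)
  ultimately show ?thesis by (simp add: card_image)
qed

lemma card_preds_filter:
  assumes h: "hole c v" and l: "\<not> E v (hd c)"
  shows "card {a \<in> succs (rev c) (nb v). P a} = card {i. Suc i < length c \<and> E v (c ! Suc i) \<and> P (c ! i)}"
proof -
  have ne: "c \<noteq> []" "distinct c" using h by (auto simp: longest_def is_cycle_def)
  have "{a \<in> succs (rev c) (nb v). P a} = (\<lambda>i. c ! i) ` {i. Suc i < length c \<and> E v (c ! Suc i) \<and> P (c ! i)}"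
    using succs_rev_index[OF ne(1), of "nb v"] l by auto
  moreover have "inj_on (\<lambda>i. c ! i) {i. Suc i < length c \<and> E v (c ! Suc i) \<and> P (c ! i)}"
    using ne(2) by (auto simp: inj_on_def nth_eq_iff_index_eq)
  ultimately show ?thesis by (simp add: card_image)
qed

lemma last_not_nb: "hole c v \<Longrightarrow> E v (hd c) \<Longrightarrow> \<not> E v (last c)"
  using hole_no_consecutive[of c v "last c" "hd c"] sym
  by (metis arcs_iff hd_in_set empty_iff list.set(1) nb_subset_hole mem_Collect_eq subsetD)

lemma last_in_preds: "hole c v \<Longrightarrow> E v (hd c) \<Longrightarrow> last c \<in> succs (rev c) (nb v)"
  by (subst succs_rev_index) (auto simp: longest_def is_cycle_def)

lemma nth_no_consecutive: "hole c v \<Longrightarrow> Suc i < length c \<Longrightarrow> E v (c ! i) \<Longrightarrow> \<not> E v (c ! Suc i)"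
  using hole_no_consecutive[of c v "c ! i" "c ! Suc i"] by (auto simp: arcs_iff)

text \<open>The uncovered vertex can be moved from v to any successor that is adjacent to a predecessor,
  without destroying the arc from that predecessor.\<close>

lemma move_hole_keep_arc:
  assumes h: "hole c v" and hd: "E v (hd c)" and a: "a \<in> succs c (nb v)" "E a (last c)"
  shows "\<exists>c'. hole c' a \<and> hd c' = hd c \<and> last c' = last c"
proof -
  have ne: "c \<noteq> []" "distinct c" using h by (auto simp: longest_def is_cycle_def)
  note l = last_not_nb[OF h hd]
  obtain g where g: "Suc g < length c" "E v (c ! g)" "a = c ! Suc g"
    using a(1) succs_index[OF ne(1), of "nb v"] l by auto
  have "Suc g \<noteq> length c - 1" using a(2) g ne irrefl by (metis last_conv_nth)
  then have g2: "Suc (Suc g) < length c" using g(1) by linarith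
  let ?q = "c ! Suc (Suc g)"
  have aq: "E ?q a"
    using arcs_adj[of c a ?q] g g2 h sym by (metis arcs_iff)
  \<comment> \<open>Otherwise \<open>a\<close> and \<open>last c\<close> would be adjacent
    predecessors of N(v).\<close>
  have nvq: "\<not> E v ?q"
  proof
    assume "E v ?q"
    then have "a \<in> succs (rev c) (nb v)"
      using succs_rev_index[OF ne(1), of "nb v"] g g2 by auto
    then show False
      using succs_independent[OF hole_rev[OF h]] last_in_preds[OF h hd] a(2) by blast
  qed
  \<comment> \<open>The vertex after \<open>a\<close> misses at most k - 2 successors; a second
    neighbour among them supplies the chord for \<open>reroute\<close>.\<close>
  have "2 \<le> card {a \<in> succs c (nb v). E ?q a}"
    using succs_neighbours_card[OF h nvq a(1) aq] degree_ge_k[of v] h by linarith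
  then obtain a' where a': "a' \<in> succs c (nb v)" "a' \<noteq> a" "E ?q a'"
    using another_succs_neighbour[OF h] by blast
  obtain i where i: "Suc i < length c" "E v (c ! i)" "a' = c ! Suc i"
    using a'(1) succs_index[OF ne(1), of "nb v"] l by auto
  have "i \<noteq> g" using a'(2) i(3) g(3) by blast
  moreover have "i \<noteq> Suc g" using succs_not_nb[OF h a(1)] i(2) g(3) by blast
  ultimately obtain c' where "longest c'" "a \<notin> set c'" "hd c' = hd c" "last c' = last c"
    using reroute[of c v i g] h i g g2 a'(3) by metis
  moreover have "a \<in> V" using a(1) succs_subset_V[OF h] by blast
  ultimately show ?thesis by blast
qed

text \<open>Once the hole is moved to \<open>a\<close> with the closing arc kept, \<open>a\<close>
  could be inserted into that arc.\<close>

lemma succ_adj_last_not_adj_hd: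
  assumes h: "hole c v" and hd: "E v (hd c)" and a: "a \<in> succs c (nb v)" "E a (last c)"
  shows "\<not> E a (hd c)"
proof
  assume "E a (hd c)"
  obtain c' where "hole c' a" "hd c' = hd c" "last c' = last c"
    using move_hole_keep_arc[OF assms] by blast
  then show False
    using no_insert[of c' "[a]"] a(2) \<open>E a (hd c)\<close> sym by simp
qed

lemma move_hole:
  assumes h: "hole c v" and a: "a \<in> succs c (nb v)" "b \<in> succs (rev c) (nb v)" "E a b"
  shows "\<exists>c'. hole c' a"
proof -
  obtain x where x: "E v x" "(b, x) \<in> arcs c" using a(2) by (auto simp: succs_def arcs_rev)
  then obtain c' where "longest c'" "set c' = set c" "arcs c' = arcs c" "hd c' = x" "last c' = b"
    using longest_rotate_to[of c b x] h by metis
  then show ?thesis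
    using move_hole_keep_arc[of c' v a] h a x by (auto simp: succs_def)
qed

text \<open>A chord from \<open>hd c\<close> to either cycle neighbour of the later vertex
  \<open>c ! h\<close>, the chord from \<open>c ! Suc g\<close> to \<open>last c\<close> and the
  detour through \<open>v\<close> would make a longer cycle.\<close>

lemma hd_misses_after:
  assumes h: "hole c v" and hd: "E v (hd c)"
    and g: "Suc g < length c" "E v (c ! g)" "E (c ! Suc g) (last c)"
    and h': "Suc h < length c" "E v (c ! h)" "g < h"
  shows "\<not> E (hd c) (c ! Suc h)" "\<not> E (hd c) (c ! (h - 1))"
proof -
  have hd0: "hd c = c ! 0" using g(1) by (metis hd_conv_nth list.size(3) not_less_zero)
  show "\<not> E (hd c) (c ! Suc h)"
    using no_cross_ends[of c v "Suc g" "Suc h"] assms hd0 sym by auto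
  have "h \<noteq> Suc g" using nth_no_consecutive[OF h g(1,2)] h'(2) by blast
  then show "\<not> E (hd c) (c ! (h - 1))"
    using no_cross_shift[of c v "Suc g" h] assms hd0 sym by auto
qed

lemma hd_misses_before:
  assumes h: "hole c v"
    and j: "j < length c" "E v (c ! j)" "E (c ! 1) (c ! (j - 1))"
    and i: "0 < i" "i < j" "E v (c ! i)"
  shows "\<not> E (hd c) (c ! Suc i)"
proof
  assume E: "E (hd c) (c ! Suc i)"
  have ne: "c \<noteq> []" using i j by auto
  \<comment> \<open>After rotation by one place \<open>hd c\<close> is last and \<open>c ! 1\<close>
    is first, so \<open>no_cross_shift\<close> applies with all indices lowered by one.\<close>
  let ?c = "tl c @ [hd c]"
  have L: "longest ?c"
    using h is_cycle_append_commute[of E "[hd c]" "tl c"] ne by (auto simp: longest_def)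
  have nth: "?c ! m = c ! Suc m" if "Suc m < length c" for m
    using that ne by (auto simp: nth_append nth_tl)
  have ij: "Suc i \<noteq> j" using nth_no_consecutive[OF h _ i(3)] j(1,2) by blast
  have "v \<notin> set ?c" using h ne by (metis hd_Cons_tl rotate1.simps(2) set_rotate1)
  moreover have "0 < i" "i < j - 1" "j - 1 < length ?c" using i ij j by auto
  moreover have "E v (?c ! (i - 1))" "E v (?c ! (j - 1))" using nth[of "i - 1"] nth[of "j - 1"] i j by auto
  moreover have "E (?c ! i) (last ?c)" using nth[of i] i j E sym by auto
  moreover have "E (?c ! (j - 1 - 1)) (?c ! 0)"
  proof -
    have "j - 1 - 1 = j - 2" "Suc (j - 2) = j - 1" using ij i by auto
    then have "?c ! (j - 1 - 1) = c ! (j - 1)" "?c ! 0 = c ! 1" using nth[of "j - 2"] nth[of 0] i j by auto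
    then show ?thesis using j(3) sym by metis
  qed
  ultimately show False using no_cross_shift[OF L] by blast
qed

text \<open>\<open>hd c\<close> misses the successors at all positions of N(v) from
  \<open>g = Min J\<close> on and at all positive ones before \<open>j = Max K\<close>. If these
  ranges are disjoint they are too large; otherwise they cover every position but 0.\<close>

lemma two_sided:
  assumes h: "hole c v" and hd: "E v (hd c)"
    and a: "a \<in> succs c (nb v)" "E a (last c)"
    and b: "b \<in> succs (rev c) (nb v)" "E (c ! 1) b"
  shows "k = 3 \<and> card (nb v) = 3"
proof -
  let ?n = "length c" and ?d = "card (nb v)"
  have ne: "c \<noteq> []" "distinct c" "3 \<le> ?n" using h by (auto simp: longest_def is_cycle_def)
  have hd0: "hd c = c ! 0" using ne(1) by (simp add: hd_conv_nth)
  have vV: "v \<in> V" using h by blast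
  note l = last_not_nb[OF h hd]
  define S where "S = {i. Suc i < ?n \<and> E v (c ! i)}"
  have finS: "finite S" unfolding S_def by (rule finite_subset[of _ "{..<?n}"]) auto
  have "card {a \<in> succs c (nb v). True} = card {i. Suc i < ?n \<and> E v (c ! i) \<and> True}"
    by (rule card_succs_filter[OF h l])
  then have cS: "card S = ?d" using card_succs_nb[OF h] by (simp add: S_def)
  have miss: "card {i \<in> S. \<not> E (hd c) (c ! Suc i)} < k"
  proof -
    let ?I = "insert v (succs c (nb v))"
    have "{i. Suc i < ?n \<and> E v (c ! i) \<and> \<not> E (hd c) (c ! Suc i)} = {i \<in> S. \<not> E (hd c) (c ! Suc i)}"
      by (auto simp: S_def)
    moreover have "{a \<in> succs c (nb v). \<not> E (hd c) a} = {s \<in> ?I. \<not> E (hd c) s}"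
      using hd sym by blast
    moreover have "card {s \<in> ?I. \<not> E (hd c) s} < k"
      using non_neighbours_card[of ?I v "hd c"] insert_succs_independent[OF h]
        succs_subset_V[OF h] vV hd sym by blast
    ultimately show ?thesis using card_succs_filter[OF h l, of "\<lambda>a. \<not> E (hd c) a"] by metis
  qed
  define J where "J = {i \<in> S. E (c ! Suc i) (last c)}"
  have cJ: "?d + 2 \<le> card J + k"
  proof -
    have "J = {i. Suc i < ?n \<and> E v (c ! i) \<and> E (last c) (c ! Suc i)}"
      using sym_iff by (auto simp: J_def S_def)
    then show ?thesis
      using succs_neighbours_card[OF h l a(1) sym[OF a(2)]] card_succs_filter[OF h l, of "E (last c)"] by metis
  qed
  have missJ: "\<not> E (hd c) (c ! Suc g)" if "g \<in> J" for g
  proof -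
    have "c ! Suc g \<in> succs c (nb v)"
      using that succs_index[OF ne(1), of "nb v"] l by (auto simp: J_def S_def)
    then show ?thesis
      using succ_adj_last_not_adj_hd[OF h hd, of "c ! Suc g"] that sym by (auto simp: J_def)
  qed
  have adj01: "E (hd c) (c ! 1)"
    using arcs_adj[of c "hd c" "c ! 1"] h hd0 ne(3) unfolding arcs_iff by force
  then have J0: "0 \<notin> J" using missJ[of 0] by auto
  have finJ: "finite J" using finS by (simp add: J_def)
  have neJ: "J \<noteq> {}" using cJ degree_ge_k[OF vV] by auto
  define g where "g = Min J"
  have g: "g \<in> J" "\<And>i. i \<in> J \<Longrightarrow> g \<le> i" using finJ neJ by (auto simp: g_def)
  have g0: "0 < g" using g J0 by (metis gr0I)
  have nv1: "\<not> E v (c ! 1)" using nth_no_consecutive[OF h, of 0] hd hd0 ne(3) by simp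
  have zS: "0 \<in> S" using hd hd0 ne(3) by (simp add: S_def)
  have c1: "c ! 1 \<in> succs c (nb v)"
    using zS succs_index[OF ne(1), of "nb v"] l by (auto simp: S_def)
  define K where "K = {j \<in> S. 0 < j \<and> E (c ! 1) (c ! (j - 1))}"
  have cK: "?d + 2 \<le> card K + k"
  proof -
    have "{b \<in> succs (rev c) (nb v). E (c ! 1) b} \<subseteq> (\<lambda>j. c ! (j - 1)) ` K"
    proof
      fix b assume b: "b \<in> {b \<in> succs (rev c) (nb v). E (c ! 1) b}"
      \<comment> \<open>\<open>c ! 1\<close> is adjacent to \<open>hd c\<close>, hence not to
        \<open>last c\<close>; no element of the count is lost at the closing arc.\<close>
      have "b \<noteq> last c"
        using b succ_adj_last_not_adj_hd[OF h hd c1] adj01 sym by blast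
      then obtain i where i: "Suc i < ?n" "E v (c ! Suc i)" "b = c ! i"
        using b succs_rev_index[OF ne(1), of "nb v"] by (auto split: if_splits)
      have "Suc i \<noteq> ?n - 1" using i(2) l ne(1) by (metis last_conv_nth)
      then have "Suc i \<in> K" using i b by (auto simp: K_def S_def)
      then show "b \<in> (\<lambda>j. c ! (j - 1)) ` K" using i(3) by force
    qed
    moreover have "finite K" using finS by (simp add: K_def)
    ultimately have "card {b \<in> succs (rev c) (nb v). E (c ! 1) b} \<le> card K"
      by (meson card_image_le card_mono finite_imageI le_trans)
    then show ?thesis using succs_neighbours_card[OF hole_rev[OF h] nv1 b] by linarith
  qed
  have finK: "finite K" using finS by (simp add: K_def)
  have neK: "K \<noteq> {}" using cK degree_ge_k[OF vV] by auto
  define j where "j = Max K"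
  have j: "j \<in> K" "\<And>i. i \<in> K \<Longrightarrow> i \<le> j" using finK neK by (auto simp: j_def)
  let ?M = "{i \<in> S. \<not> E (hd c) (c ! Suc i)}"
  have M1: "{i \<in> S. g \<le> i} \<subseteq> ?M"
  proof
    fix i assume i: "i \<in> {i \<in> S. g \<le> i}"
    show "i \<in> ?M"
    proof (cases "i = g")
      case True then show ?thesis using missJ[OF g(1)] i by simp
    next
      case False then show ?thesis
        using hd_misses_after(1)[OF h hd, of g i] g(1) i by (auto simp: J_def S_def)
    qed
  qed
  have M2: "{i \<in> S. 0 < i \<and> i < j} \<subseteq> ?M"
    using hd_misses_before[OF h, of j] j(1) by (auto simp: K_def S_def)
  have "card J \<le> card {i \<in> S. g \<le> i}"
    using g(2) finS by (intro card_mono) (auto simp: J_def)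
  moreover have "card K \<le> Suc (card {i \<in> S. 0 < i \<and> i < j})"
  proof -
    have "K \<subseteq> insert j {i \<in> S. 0 < i \<and> i < j}"
      using j(2) by (auto simp: K_def le_less)
    then have "card K \<le> card (insert j {i \<in> S. 0 < i \<and> i < j})"
      using finS by (intro card_mono) auto
    also have "\<dots> \<le> Suc (card {i \<in> S. 0 < i \<and> i < j})" using finS by (simp add: card_insert_if)
    finally show ?thesis .
  qed
  moreover have "card ({i \<in> S. g \<le> i} \<union> {i \<in> S. 0 < i \<and> i < j}) \<le> card ?M"
    using M1 M2 finS by (intro card_mono) auto
  moreover have "card J \<le> ?d - 1"
  proof -
    have "J \<subseteq> S - {0}" using J0 by (auto simp: J_def)
    then have "card J \<le> card (S - {0})" using finS by (intro card_mono) auto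
    then show ?thesis using cS zS finS by simp
  qed
  ultimately have facts: "card J \<le> card {i \<in> S. g \<le> i}" "card K \<le> Suc (card {i \<in> S. 0 < i \<and> i < j})"
    "card ({i \<in> S. g \<le> i} \<union> {i \<in> S. 0 < i \<and> i < j}) < k" "card J \<le> ?d - 1"
    using miss by linarith+
  show ?thesis
  proof (cases "j \<le> g")
    case True
    then have "{i \<in> S. g \<le> i} \<inter> {i \<in> S. 0 < i \<and> i < j} = {}" by auto
    then have "card {i \<in> S. g \<le> i} + card {i \<in> S. 0 < i \<and> i < j} < k"
      using facts(3) finS by (subst (asm) card_Un_disjoint) auto
    \<comment> \<open>With d the degree of \<open>v\<close>, this gives 2(d + 2 - k) \<le> k,
      against 3k \<le> 2d + 3.\<close>
    then show ?thesis using facts(1,2) cJ cK degree_bound[OF vV] by linarith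
  next
    case False
    then have "S - {0} \<subseteq> {i \<in> S. g \<le> i} \<union> {i \<in> S. 0 < i \<and> i < j}" by auto
    then have "card (S - {0}) \<le> card ({i \<in> S. g \<le> i} \<union> {i \<in> S. 0 < i \<and> i < j})"
      using finS by (intro card_mono) auto
    moreover have "card (S - {0}) = ?d - 1" using cS zS finS by simp
    \<comment> \<open>Now d - 1 < k forces d = k, the degree bound gives k \<le> 3, and d + 2 - k
      \<le> \<open>card J\<close> \<le> d - 1 gives k \<ge> 3.\<close>
    ultimately show ?thesis
      using facts(3,4) cJ degree_bound[OF vV] degree_ge_k[OF vV] k_ge_2 by linarith
  qed
qed

lemma one_sided:
  assumes h: "hole c v" and hd: "E v (hd c)"
    and a: "a \<in> succs c (nb v)" "E a (last c)"
    and no: "\<And>x p s a b. E v x \<Longrightarrow> (p, x) \<in> arcs c \<Longrightarrow> (x, s) \<in> arcs c \<Longrightarrow>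
       a \<in> succs c (nb v) \<Longrightarrow> E a p \<Longrightarrow> b \<in> succs (rev c) (nb v) \<Longrightarrow> E s b \<Longrightarrow> False"
  shows False
proof -
  let ?n = "length c" and ?d = "card (nb v)" and ?A = "succs c (nb v)" and ?B = "succs (rev c) (nb v)"
  have ne: "c \<noteq> []" "distinct c" "3 \<le> ?n" using h by (auto simp: longest_def is_cycle_def)
  have hd0: "hd c = c ! 0" using ne(1) by (simp add: hd_conv_nth)
  have vV: "v \<in> V" using h by blast
  note l = last_not_nb[OF h hd]
  note lB = last_in_preds[OF h hd]
  define J where "J = {i. Suc i < ?n \<and> E v (c ! i) \<and> E (last c) (c ! Suc i)}"
  have cJ: "?d + 2 \<le> card J + k"
    using succs_neighbours_card[OF h l a(1) sym[OF a(2)]] card_succs_filter[OF h l, of "E (last c)"]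
    by (simp add: J_def)
  have JA: "c ! Suc i \<in> ?A" if "i \<in> J" for i
    using that succs_index[OF ne(1), of "nb v"] l by (auto simp: J_def)
  have adj01: "E (hd c) (c ! 1)"
    using arcs_adj[of c "hd c" "c ! 1"] h hd0 ne(3) unfolding arcs_iff by force
  have missJ: "\<not> E (hd c) (c ! Suc g)" if "g \<in> J" for g
    using succ_adj_last_not_adj_hd[OF h hd JA[OF that]] that sym by (auto simp: J_def)
  then have J0: "0 \<notin> J" using adj01 by auto
  have finJ: "finite J" unfolding J_def by (rule finite_subset[of _ "{..<?n}"]) auto
  have neJ: "J \<noteq> {}" using cJ degree_ge_k[OF vV] by auto
  define g where "g = Min J"
  have g: "g \<in> J" "\<And>i. i \<in> J \<Longrightarrow> g \<le> i" using finJ neJ by (auto simp: g_def)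
  \<comment> \<open>\<open>X\<close> and \<open>Y\<close> consist of non-neighbours of
    \<open>hd c\<close>. The index \<open>g\<close> is left out of \<open>Y\<close> because
    \<open>hd_misses_after\<close> only reaches later indices.\<close>
  define X where "X = (\<lambda>i. c ! Suc i) ` J"
  define Y where "Y = (\<lambda>i. c ! (i - 1)) ` (J - {g})"
  have XA: "X \<subseteq> ?A" using JA by (auto simp: X_def)
  have pos: "0 < i" if "i \<in> J" for i using that J0 by (metis gr0I)
  have YB: "Y \<subseteq> ?B"
  proof -
    have "c ! (i - 1) \<in> ?B" if "i \<in> J" for i
    proof -
      have "Suc (i - 1) = i" using pos[OF that] by simp
      moreover have "Suc i < ?n" "E v (c ! i)" using that by (auto simp: J_def)
      ultimately show ?thesis
        using succs_rev_index[OF ne(1), of "nb v"] by (auto intro!: exI[of _ "i - 1"])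
    qed
    then show ?thesis by (auto simp: Y_def)
  qed
  \<comment> \<open>For \<open>i\<close> in \<open>J\<close> the successor of \<open>c ! i\<close>
    is adjacent to \<open>last c\<close>, a predecessor of N(v). By the assumption
    \<open>no\<close>, the predecessor of \<open>c ! i\<close> then has no neighbour among the
    successors.\<close>
  have YA: "\<not> E a y" if "a \<in> ?A" "y \<in> Y" for a y
  proof
    assume E: "E a y"
    from that(2) obtain i where i: "i \<in> J" "y = c ! (i - 1)" by (auto simp: Y_def)
    have "Suc (i - 1) = i" using pos[OF i(1)] by simp
    moreover have i': "Suc i < ?n" "E v (c ! i)" "E (last c) (c ! Suc i)" using i(1) by (auto simp: J_def)
    ultimately have "(c ! (i - 1), c ! i) \<in> arcs c" "(c ! i, c ! Suc i) \<in> arcs c"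
      unfolding arcs_iff by (metis Suc_lessD)+
    then show False
      using no[of "c ! i" "c ! (i - 1)" "c ! Suc i" a "last c"] i' that(1) E i(2) lB sym by blast
  qed
  let ?I = "insert v ?A \<union> Y"
  have "\<forall>x\<in>?I. \<forall>y\<in>?I. \<not> E x y"
    using insert_succs_independent[OF h] insert_succs_independent[OF hole_rev[OF h]] YA YB sym by blast
  moreover have "?I \<subseteq> V"
    using succs_subset_V[OF h] succs_subset_V[OF hole_rev[OF h]] YB vV by blast
  ultimately have "card {s \<in> ?I. \<not> E (hd c) s} < k"
    using non_neighbours_card[of ?I v "hd c"] hd sym by blast
  moreover have "X \<union> Y \<subseteq> {s \<in> ?I. \<not> E (hd c) s}"
  proof -
    have "\<not> E (hd c) y" if "y \<in> Y" for y
    proof -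
      from that obtain i where i: "i \<in> J" "i \<noteq> g" "y = c ! (i - 1)" by (auto simp: Y_def)
      then have "g < i" using g(2)[of i] by simp
      then show ?thesis
        using hd_misses_after(2)[OF h hd, of g i] i g(1) sym by (auto simp: J_def)
    qed
    then show ?thesis using XA missJ by (auto simp: X_def)
  qed
  moreover have "finite {s \<in> ?I. \<not> E (hd c) s}"
    by (rule finite_subset_V) (use \<open>?I \<subseteq> V\<close> in blast)
  ultimately have "card (X \<union> Y) < k"
    using card_mono[of "{s \<in> ?I. \<not> E (hd c) s}" "X \<union> Y"] by linarith
  \<comment> \<open>\<open>last c\<close> is adjacent to all of \<open>X\<close>, but shares an
    independent set with \<open>Y\<close>.\<close>
  moreover have "X \<inter> Y = {}"
  proof -
    have "E (last c) x" if "x \<in> X" for x using that by (auto simp: X_def J_def)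
    then show ?thesis using succs_independent[OF hole_rev[OF h] lB] YB by blast
  qed
  moreover have "card X = card J"
    unfolding X_def using ne(2) by (intro card_image) (auto simp: inj_on_def J_def nth_eq_iff_index_eq)
  moreover have "card Y = card J - 1"
  proof -
    have "inj_on (\<lambda>i. c ! (i - 1)) (J - {g})"
    proof (rule inj_onI)
      fix x y assume xy: "x \<in> J - {g}" "y \<in> J - {g}" "c ! (x - 1) = c ! (y - 1)"
      then have "x - 1 < ?n" "y - 1 < ?n" by (auto simp: J_def)
      then have "x - 1 = y - 1" using xy(3) ne(2) nth_eq_iff_index_eq by blast
      then show "x = y" using pos[of x] pos[of y] xy(1,2) by auto
    qed
    then show ?thesis unfolding Y_def using g(1) finJ by (simp add: card_image)
  qed
  moreover have "finite X" "finite Y" using finJ by (auto simp: X_def Y_def)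
  \<comment> \<open>The union has at least 2(d + 2 - k) - 1 elements, which is at least k by the
    degree bound.\<close>
  ultimately show False
    using cJ degree_bound[OF vV] degree_ge_k[OF vV] by (simp add: card_Un_disjoint)
qed

section \<open>No edge between successors and predecessors\<close>

text \<open>With two such neighbours, both \<open>v\<close> and \<open>w\<close> could be inserted
  at once by \<open>no_cross_two\<close>.\<close>

lemma outside_one_succ_neighbour:
  assumes h: "hole c v" and w: "w \<notin> set c" "w \<noteq> v"
    and a: "a1 \<in> succs c (nb v)" "a2 \<in> succs c (nb v)" "E w a1" "E w a2"
  shows "a1 = a2"
proof (rule ccontr)
  assume "a1 \<noteq> a2"
  obtain x where "E v x" using a(1) by (auto simp: succs_def)
  then obtain y where "(y, x) \<in> arcs c" using nb_subset_hole[OF h] arcs_pred_ex[of x c] by blast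
  then obtain c' where c': "longest c'" "set c' = set c" "arcs c' = arcs c" "hd c' = x"
    using longest_rotate_to[of c y x] h by metis
  have h': "hole c' v" using h c' by simp
  have "c' \<noteq> []" "\<not> E v (last c')"
    using h' last_not_nb[OF h'] c'(4) \<open>E v x\<close> by (auto simp: longest_def is_cycle_def)
  then have A: "succs c (nb v) = {c' ! Suc i | i. Suc i < length c' \<and> c' ! i \<in> nb v}"
    using succs_index[of c' "nb v"] c'(3) by (simp add: succs_def)
  obtain i where i: "Suc i < length c'" "E v (c' ! i)" "a1 = c' ! Suc i" using a(1) A by auto
  obtain j where j: "Suc j < length c'" "E v (c' ! j)" "a2 = c' ! Suc j" using a(2) A by auto
  have "i \<noteq> j" using \<open>a1 \<noteq> a2\<close> i j by blast
  then show False
    using no_cross_two[of c' v w "Suc i" "Suc j"] no_cross_two[of c' v w "Suc j" "Suc i"] i j a(3,4) w h' c'(2)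
    by (cases "i < j") auto
qed

lemma ex_succ_pred_edge:
  assumes h: "hole c v"
  shows "\<exists>a\<in>succs c (nb v). \<exists>b\<in>succs (rev c) (nb v). E a b"
proof (rule ccontr)
  let ?A = "succs c (nb v)" and ?B = "succs (rev c) (nb v)" and ?d = "card (nb v)"
  assume "\<not> ?thesis"
  then have no: "\<And>a b. a \<in> ?A \<Longrightarrow> b \<in> ?B \<Longrightarrow> \<not> E a b" by blast
  have vV: "v \<in> V" using h by blast
  define I where "I = insert v (?A \<union> ?B)"
  have I_ind: "\<forall>x\<in>I. \<forall>y\<in>I. \<not> E x y"
    using insert_succs_independent[OF h] insert_succs_independent[OF hole_rev[OF h]] no sym
    unfolding I_def by blast
  have I_V: "I \<subseteq> V"
    using succs_subset_V[OF h] succs_subset_V[OF hole_rev[OF h]] vV unfolding I_def by blast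
  have "?A \<subseteq> I" by (auto simp: I_def)
  then have "card ?A \<le> card I" using finite_subset_V[OF I_V] card_mono by blast
  then have cI: "k \<le> card I" using card_succs_nb[OF h] degree_ge_k[OF vV] by linarith
  define P where "P = {z \<in> V. \<forall>i\<in>I. \<not> E z i}"
  \<comment> \<open>An edge inside \<open>P\<close> together with k elements of \<open>I\<close>
    would form the forbidden subgraph.\<close>
  have P_ind: "\<not> E x y" if "x \<in> P" "y \<in> P" for x y
    using free[of x y I] I_V I_ind that cI unfolding P_def by auto
  have IP: "I \<subseteq> P" using I_V I_ind by (auto simp: P_def)
  have P_V: "P \<subseteq> V" by (auto simp: P_def)
  have cP: "2 * card P \<le> card V" using independent_card[OF P_V] P_ind by blast
  have AI: "insert v ?A \<subseteq> I" and BI: "insert v ?B \<subseteq> I" by (auto simp: I_def)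
  have countA: "?d + 2 \<le> card {a \<in> ?A. E q a} + k" if q: "q \<in> V" "q \<notin> P" "\<not> E v q" for q
  proof -
    obtain p where "p \<in> I" "E q p" using q(1,2) unfolding P_def by blast
    then show ?thesis
      using succs_neighbours_card_of_superset[OF h q(3) _ _ AI I_V I_ind] by blast
  qed
  have countB: "?d + 2 \<le> card {b \<in> ?B. E q b} + k" if q: "q \<in> V" "q \<notin> P" "\<not> E v q" for q
  proof -
    obtain p where "p \<in> I" "E q p" using q(1,2) unfolding P_def by blast
    then show ?thesis
      using succs_neighbours_card_of_superset[OF hole_rev[OF h] q(3) _ _ BI I_V I_ind] by blast
  qed
  have Q_c: "V - P \<subseteq> set c"
  proof
    fix w assume w: "w \<in> V - P"
    show "w \<in> set c"
    proof (rule ccontr)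
      assume wc: "w \<notin> set c"
      have "w \<noteq> v" using w IP by (auto simp: I_def)
      moreover have "\<not> E v w" using outside_independent h wc by blast
      then have "2 \<le> card {a \<in> ?A. E w a}"
        using countA[of w] w degree_ge_k[OF vV] by force
      then obtain a a' where "a \<in> ?A" "a' \<in> ?A" "a' \<noteq> a" "E w a" "E w a'"
        using another_succs_neighbour[OF h] by metis
      ultimately show False using outside_one_succ_neighbour[OF h wc] by blast
    qed
  qed
  \<comment> \<open>Otherwise the successor map would embed \<open>V - P\<close> into
    \<open>P - {v}\<close>, so that |V| < 2|P|.\<close>
  have "\<not> succs c (V - P) \<subseteq> P"
  proof
    assume "succs c (V - P) \<subseteq> P"
    moreover have "v \<notin> succs c (V - P)" using succs_subset[of c "V - P"] h by blast
    ultimately have "succs c (V - P) \<subseteq> P - {v}" by blast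
    then have "card (succs c (V - P)) \<le> card (P - {v})"
      using finite_subset_V[OF P_V] by (intro card_mono) auto
    moreover have "v \<in> P" using IP by (auto simp: I_def)
    then have "card (P - {v}) < card P" using finite_subset_V[OF P_V] by (meson card_Diff1_less)
    moreover have "card (succs c (V - P)) = card V - card P"
      using card_succs[OF _ Q_c] h finite_subset_V[OF P_V] P_V
      by (simp add: card_Diff_subset longest_def is_cycle_def)
    ultimately show False using cP by linarith
  qed
  then obtain y z where yz: "y \<in> V - P" "(y, z) \<in> arcs c" "z \<notin> P" by (auto simp: succs_def)
  have zV: "z \<in> V" using yz(2) arcs_subset[of c] longest_subset[of c] h by blast
  have nvy: "\<not> E v y"
  proof
    assume "E v y"
    then have "z \<in> ?A" using yz(2) by (auto simp: succs_def)
    then show False using yz(3) IP by (auto simp: I_def)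
  qed
  have nvz: "\<not> E v z"
  proof
    assume "E v z"
    then have "y \<in> ?B" using yz(2) by (auto simp: succs_def arcs_rev)
    then show False using yz(1) IP by (auto simp: I_def)
  qed
  obtain c' where c': "longest c'" "set c' = set c" "arcs c' = arcs c" "arcs (rev c') = arcs (rev c)"
    "hd c' = z" "last c' = y"
    using longest_rotate_to[of c y z] h yz(2) by metis
  have h': "hole c' v" using h c' by simp
  have ne: "c' \<noteq> []" using c'(1) by (auto simp: longest_def is_cycle_def)
  have A: "succs c' (nb v) = ?A" and B: "succs (rev c') (nb v) = ?B" using c' by (simp_all add: succs_def)
  have z0: "c' ! 0 = z" using ne c'(5) by (simp add: hd_conv_nth)
  let ?n = "length c'"
  define S where "S = {i. Suc i < ?n \<and> E v (c' ! i)}"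
  have finS: "finite S" unfolding S_def by (rule finite_subset[of _ "{..<?n}"]) auto
  have "card {a \<in> succs c' (nb v). True} = card {i. Suc i < ?n \<and> E v (c' ! i) \<and> True}"
    using card_succs_filter[OF h', of "\<lambda>_. True"] nvy c'(6) by fast
  then have cS: "card S = ?d" using card_succs_nb[OF h] A by (simp add: S_def)
  define J where "J = {i. Suc i < ?n \<and> E v (c' ! i) \<and> E y (c' ! Suc i)}"
  define J' where "J' = {i. Suc i < ?n \<and> E v (c' ! i) \<and> E z (c' ! Suc i)}"
  \<comment> \<open>All three sets hold positions of vertices of N(v); \<open>Suc\<close> moves from
    a predecessor to the vertex of N(v) after it.\<close>
  define K where "K = Suc ` {i. Suc i < ?n \<and> E v (c' ! Suc i) \<and> E y (c' ! i)}"
  have cJ: "?d + 2 \<le> card J + k"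
    using countA[of y] yz(1) nvy card_succs_filter[OF h', of "E y"] A c'(6) by (simp add: J_def)
  have cJ': "?d + 2 \<le> card J' + k"
    using countA[of z] yz(3) zV nvz nvy card_succs_filter[OF h', of "E z"] A c'(6) by (simp add: J'_def)
  have cK: "?d + 2 \<le> card K + k"
    using countB[of y] yz(1) nvy nvz card_preds_filter[OF h', of "E y"] B c'(5) by (simp add: K_def card_image)
  have K: "K \<subseteq> S"
  proof
    fix m assume "m \<in> K"
    then have m: "m < ?n" "E v (c' ! m)" by (auto simp: K_def)
    then have "m \<noteq> ?n - 1" using nvy c'(6) ne by (metis last_conv_nth)
    then show "m \<in> S" using m by (auto simp: S_def)
  qed
  have JJ: "J \<subseteq> S" "J' \<subseteq> S" by (auto simp: J_def J'_def S_def)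
  note fins = finite_subset[OF K finS] finite_subset[OF JJ(1) finS] finite_subset[OF JJ(2) finS]
  have J'J: "l \<le> j" if "l \<in> J'" "j \<in> J" for l j
  proof (rule ccontr)
    assume "\<not> l \<le> j"
    moreover have "E (c' ! Suc j) (last c')" "E (c' ! Suc l) (c' ! 0)"
      using that sym unfolding J_def J'_def z0 c'(6) by blast+
    ultimately show False
      using no_cross_ends[of c' v "Suc j" "Suc l"] h' that by (simp add: J_def J'_def)
  qed
  have KJ': "m \<le> l" if "m \<in> K" "l \<in> J'" for m l
  proof (rule ccontr)
    assume "\<not> m \<le> l"
    then have lm: "l < m" by simp
    have l: "Suc l < ?n" "E v (c' ! l)" "E z (c' ! Suc l)" using that(2) by (auto simp: J'_def)
    have m: "m < ?n" "E v (c' ! m)" "E y (c' ! (m - 1))" using that(1) by (auto simp: K_def)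
    have "Suc l \<noteq> m" using nth_no_consecutive[OF h' l(1,2)] m(2) by blast
    moreover have "E (c' ! (m - 1)) (last c')" "E (c' ! Suc l) (c' ! 0)"
      unfolding z0 c'(6) using l(3) m(3) sym by blast+
    ultimately show False
      using no_cross_ends_rev[of c' v "Suc l" m] h' l m lm by simp
  qed
  \<comment> \<open>An element of \<open>J'\<close> is what compares \<open>K\<close> with
    \<open>J\<close>.\<close>
  have "J' \<noteq> {}" using cJ' degree_ge_k[OF vV] by auto
  then have "x \<le> j" if "x \<in> K \<union> J'" "j \<in> J" for x j
    using that J'J KJ' by (metis Un_iff all_not_in_conv le_trans)
  then have "card (K \<union> J') + card J \<le> Suc (card (K \<union> J' \<union> J))"
    using fins by (intro card_ordered_pair) auto
  moreover have "card K + card J' \<le> Suc (card (K \<union> J'))"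
    using fins KJ' by (intro card_ordered_pair) auto
  moreover have "card (K \<union> J' \<union> J) \<le> card S"
    using K JJ finS by (intro card_mono) auto
  \<comment> \<open>At most two end points are counted twice, so 3(d + 2 - k) \<le> d + 2, against
    the degree bound.\<close>
  ultimately show False
    using cS cJ cJ' cK degree_bound[OF vV] degree_ge_k[OF vV] by linarith
qed

text \<open>Some edge joins A and B. If no vertex of N(v) has such edges at both of its cycle
  neighbours, \<open>one_sided\<close> is contradicted; if one does, \<open>two_sided\<close>
  applies.\<close>

lemma hole_degree:
  assumes h: "hole c v" shows "k = 3" "card (nb v) = 3"
proof -
  have "k = 3 \<and> card (nb v) = 3"
  proof (rule ccontr)
    assume n: "\<not> ?thesis"
    have no: False if x: "E v x" "(p, x) \<in> arcs c" "(x, s) \<in> arcs c"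
      and ab: "a \<in> succs c (nb v)" "E a p" "b \<in> succs (rev c) (nb v)" "E s b" for x p s a b
    proof -
      obtain c' where c': "longest c'" "set c' = set c" "arcs c' = arcs c"
        "arcs (rev c') = arcs (rev c)" "hd c' = x" "last c' = p"
        using longest_rotate_to[of c p x] h x(2) by metis
      have ne: "c' \<noteq> []" "distinct c'" "3 \<le> length c'" using c'(1) by (auto simp: longest_def is_cycle_def)
      then have "(x, c' ! 1) \<in> arcs c'" using c'(5) unfolding arcs_iff by (force simp: hd_conv_nth)
      then have "s = c' ! 1" using arcs_succ_unique[OF ne(2)] x(3) c'(3) by metis
      then show False
        using two_sided[of c' v a b] n h c' x(1) ab by (simp add: succs_def)
    qed
    obtain a b where ab: "a \<in> succs c (nb v)" "b \<in> succs (rev c) (nb v)" "E a b"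
      using ex_succ_pred_edge[OF h] by blast
    obtain x where x: "E v x" "(b, x) \<in> arcs c" using ab(2) by (auto simp: succs_def arcs_rev)
    obtain c' where c': "longest c'" "set c' = set c" "arcs c' = arcs c"
      "arcs (rev c') = arcs (rev c)" "hd c' = x" "last c' = b"
      using longest_rotate_to[of c b x] h x(2) by metis
    show False
    proof (rule one_sided[of c' v a])
      show "hole c' v" "E v (hd c')" "E a (last c')" using h c' x ab by auto
      show "a \<in> succs c' (nb v)" using ab c' by (simp add: succs_def)
    next
      fix x p s a b
      assume "E v x" "(p, x) \<in> arcs c'" "(x, s) \<in> arcs c'" "a \<in> succs c' (nb v)" "E a p"
        "b \<in> succs (rev c') (nb v)" "E s b"
      then show False using no[of x p s a b] c'(3,4) by (simp add: succs_def)
    qed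
  qed
  then show "k = 3" "card (nb v) = 3" by auto
qed

text \<open>With k = d = 3, \<open>p\<close> has at least two neighbours among the three successors,
  and \<open>s\<close> is not one of them because it is adjacent to \<open>x\<close>.\<close>

lemma pred_adj_succs:
  assumes h: "hole c v" and x: "E v x" "(p, x) \<in> arcs c" "(x, s) \<in> arcs c"
    and a: "a \<in> succs c (nb v)" "E a p" and a': "a' \<in> succs c (nb v)" "a' \<noteq> s"
  shows "E p a'"
proof -
  let ?A = "succs c (nb v)"
  obtain c' where c': "longest c'" "set c' = set c" "arcs c' = arcs c" "hd c' = x" "last c' = p"
    using longest_rotate_to[of c p x] h x(2) by metis
  have A: "succs c' (nb v) = ?A" using c'(3) by (simp add: succs_def)
  have h': "hole c' v" using h c' by simp
  have s: "s \<in> ?A" using x by (auto simp: succs_def)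
  have "E s x" using arcs_adj[of c x s] h x(3) sym by blast
  then have ps: "\<not> E p s"
    using succ_adj_last_not_adj_hd[OF h', of s] x(1) c'(4,5) A s sym by metis
  have "\<not> E v p" using hole_no_consecutive[OF h x(2)] x(1) by blast
  then have "card (nb v) + 2 \<le> card {a \<in> ?A. E p a} + k"
    using succs_neighbours_card[OF h _ a(1)] a(2) sym by blast
  then have "2 \<le> card {a \<in> ?A. E p a}" using hole_degree[OF h] by simp
  moreover have fA: "finite ?A" using succs_subset_V[OF h] finite_subset_V by blast
  moreover have "card (?A - {s}) = 2" using card_succs_nb[OF h] hole_degree[OF h] s fA by simp
  moreover have "{a \<in> ?A. E p a} \<subseteq> ?A - {s}" using ps by blast
  ultimately have "{a \<in> ?A. E p a} = ?A - {s}"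
    by (intro card_seteq) auto
  then show ?thesis using a' by blast
qed

section \<open>The Petersen graph\<close>

lemma hole_nine_cycle:
  assumes h: "hole c v"
  obtains x1 a1 b2 x2 a2 b3 x3 a3 b1
  where "hole [x1, a1, b2, x2, a2, b3, x3, a3, b1] v" "nb v = {x1, x2, x3}"
    "nb a1 = {x1, b2, b3}" "nb a2 = {x2, b1, b3}" "nb a3 = {x3, b1, b2}"
    "nb b1 = {x1, a2, a3}" "nb b2 = {x2, a1, a3}" "nb b3 = {x3, a1, a2}"
proof -
  obtain a b1 where ab: "a \<in> succs c (nb v)" "b1 \<in> succs (rev c) (nb v)" "E a b1"
    using ex_succ_pred_edge[OF h] by blast
  obtain x1 where x1: "E v x1" "(b1, x1) \<in> arcs c" using ab(2) by (auto simp: succs_def arcs_rev)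
  obtain d where d: "longest d" "set d = set c" "arcs d = arcs c" "arcs (rev d) = arcs (rev c)"
    "hd d = x1" "last d = b1"
    using longest_rotate_to[of c b1 x1] h x1(2) by metis
  have hd: "hole d v" using h d by simp
  let ?n = "length d" and ?A = "succs d (nb v)" and ?B = "succs (rev d) (nb v)"
  have aA: "a \<in> ?A" using ab(1) d(3) by (simp add: succs_def)
  have ne: "d \<noteq> []" "distinct d" "3 \<le> ?n" using d(1) by (auto simp: longest_def is_cycle_def)
  have d0: "d ! 0 = x1" using ne d(5) by (simp add: hd_conv_nth)
  have dn: "d ! (?n - 1) = b1" using ne d(6) by (simp add: last_conv_nth)
  have l: "\<not> E v (last d)" using last_not_nb[OF hd] d(5) x1(1) by simp
  define S where "S = {i. Suc i < ?n \<and> E v (d ! i)}"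
  have "card {a \<in> ?A. True} = card {i. Suc i < ?n \<and> E v (d ! i) \<and> True}"
    by (rule card_succs_filter[OF hd l])
  then have "card S = 3" using card_succs_nb[OF hd] hole_degree[OF hd] by (simp add: S_def)
  moreover have "0 \<in> S" using x1(1) d0 ne(3) by (simp add: S_def)
  ultimately have "card (S - {0}) = 2" by simp
  then obtain i j where "S - {0} = {i, j}" "i \<noteq> j" by (auto simp: card_2_iff)
  then obtain g q where gq: "S - {0} = {g, q}" "g < q"
    by (metis insert_commute nat_neq_iff)
  have S: "S = {0, g, q}" using gq(1) \<open>0 \<in> S\<close> by blast
  have pos: "0 < g" using gq(1) by (metis Diff_iff gr0I insertI1 singletonI)
  have g: "Suc g < ?n" "E v (d ! g)" and q: "Suc q < ?n" "E v (d ! q)" using S by (auto simp: S_def)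
  have g2: "2 \<le> g" using nth_no_consecutive[OF hd, of 0] x1(1) d0 g pos
    by (metis One_nat_def Suc_leI Suc_lessD le_neq_implies_less numeral_2_eq_2)
  have q2: "g + 2 \<le> q" using nth_no_consecutive[OF hd g] q gq(2)
    by (metis Suc_leI add_2_eq_Suc' le_neq_implies_less)
  define x2 x3 a1 a2 a3 b2 b3 where defs: "x2 = d ! g" "x3 = d ! q" "a1 = d ! 1" "a2 = d ! Suc g"
    "a3 = d ! Suc q" "b2 = d ! (g - 1)" "b3 = d ! (q - 1)"
  have arc: "(d ! m, d ! Suc m) \<in> arcs d" if "Suc m < ?n" for m
    using that unfolding arcs_iff by blast
  have arcs: "(b1, x1) \<in> arcs d" "(x1, a1) \<in> arcs d" "(b2, x2) \<in> arcs d" "(x2, a2) \<in> arcs d"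
    "(b3, x3) \<in> arcs d" "(x3, a3) \<in> arcs d"
    using x1(2) d(3) d0 arc[of 0] arc[of "g - 1"] arc[of g] arc[of "q - 1"] arc[of q] g q g2 q2 ne(3)
    by (auto simp: defs)
  have A: "?A = {a1, a2, a3}"
  proof -
    have "?A = (\<lambda>i. d ! Suc i) ` S" using succs_index[OF ne(1), of "nb v"] l by (auto simp: S_def)
    then show ?thesis using S by (auto simp: defs)
  qed
  have vx: "E v x1" "E v x2" "E v x3" using x1 g q by (auto simp: defs)
  have B: "b1 \<in> ?B" "b2 \<in> ?B" "b3 \<in> ?B"
    using vx arcs by (auto simp: succs_def arcs_rev)
  have deq: "d ! i = d ! j \<longleftrightarrow> i = j" if "i < ?n" "j < ?n" for i j
    using that ne(2) nth_eq_iff_index_eq by blast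
  have dist_a: "a1 \<noteq> a2" "a1 \<noteq> a3" "a2 \<noteq> a3"
    using deq[of 1 "Suc g"] deq[of 1 "Suc q"] deq[of "Suc g" "Suc q"] g q g2 q2 by (auto simp: defs)
  have dist_b: "b1 \<noteq> b2" "b1 \<noteq> b3" "b2 \<noteq> b3"
    using deq[of "?n - 1" "g - 1"] deq[of "?n - 1" "q - 1"] deq[of "g - 1" "q - 1"] g q g2 q2 ne
    by (auto simp: defs dn[symmetric])
  note PA = pred_adj_succs[OF hd]
  \<comment> \<open>One edge spreads to all pairs around different neighbours of \<open>v\<close>:
    first from \<open>b1\<close>, then on the reversed cycle from \<open>a2\<close> and
    \<open>a3\<close>, and finally from \<open>b2\<close> and \<open>b3\<close>.\<close>
  have Ab1: "E b1 a2" "E b1 a3"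
    using PA[OF vx(1) arcs(1,2) aA ab(3)] A dist_a by blast+
  note PB = pred_adj_succs[OF hole_rev[OF hd]]
  have ra: "(a2, x2) \<in> arcs (rev d)" "(x2, b2) \<in> arcs (rev d)" "(a3, x3) \<in> arcs (rev d)" "(x3, b3) \<in> arcs (rev d)"
    using arcs by (auto simp: arcs_rev)
  have Ba: "E a2 b3" "E a3 b2"
    using PB[OF vx(2) ra(1,2) B(1) Ab1(1)] PB[OF vx(3) ra(3,4) B(1) Ab1(2)] B dist_b by blast+
  have Ab: "E b2 a1" "E b3 a1"
    using PA[OF vx(2) arcs(3,4) _ Ba(2)] PA[OF vx(3) arcs(5,6) _ Ba(1)] A dist_a by blast+
  note adj = Ab1 Ba Ab Ab1[THEN sym] Ba[THEN sym] Ab[THEN sym] arcs[THEN arcs_adj[OF d(1)]]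
    arcs[THEN arcs_adj[OF d(1)], THEN sym]
  have deg_a: "card (nb y) = 3" if y: "y \<in> {a1, a2, a3}" for y
  proof -
    have "\<exists>b\<in>?B. E y b" using y B adj by blast
    moreover have "y \<in> ?A" using y A by blast
    \<comment> \<open>The hole can be moved to \<open>y\<close>, so the degree of \<open>v\<close>
      computed in \<open>hole_degree\<close> is also that of \<open>y\<close>.\<close>
    ultimately obtain d' where "hole d' y" using move_hole[OF hd, of y] by blast
    then show ?thesis using hole_degree by blast
  qed
  have deg_b: "card (nb y) = 3" if y: "y \<in> {b1, b2, b3}" for y
  proof -
    have "\<exists>a\<in>?A. E y a" using y A adj by blast
    moreover have "y \<in> ?B" using y B by blast
    ultimately obtain d' where "hole d' y" using move_hole[OF hole_rev[OF hd], of y] by auto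
    then show ?thesis using hole_degree by blast
  qed
  have card3: "nb y = {p, r, s}" if "card (nb y) = 3" "p \<noteq> r" "p \<noteq> s" "r \<noteq> s" "E y p" "E y r" "E y s" for y p r s
    using that card_seteq[of "nb y" "{p, r, s}"] card_ge_0_finite[of "nb y"] by auto
  have vnot: "\<not> E v y" if "y \<in> {a1, a2, a3, b1, b2, b3}" for y
    using that A B succs_not_nb[OF hd] succs_not_nb[OF hole_rev[OF hd]] by blast
  have xne: "x1 \<noteq> y" "x2 \<noteq> y" "x3 \<noteq> y" if "y \<in> {a1, a2, a3, b1, b2, b3}" for y
    using vnot[OF that] vx by blast+
  have dist_x: "x1 \<noteq> x2" "x1 \<noteq> x3" "x2 \<noteq> x3"
    using deq[of 0 g] deq[of 0 q] deq[of g q] g q g2 q2 ne(1) by (auto simp: defs d0[symmetric])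
  have nbs: "nb a1 = {x1, b2, b3}" "nb a2 = {x2, b1, b3}" "nb a3 = {x3, b1, b2}"
    "nb b1 = {x1, a2, a3}" "nb b2 = {x2, a1, a3}" "nb b3 = {x3, a1, a2}"
    using deg_a deg_b adj xne dist_a dist_b by (intro card3; blast)+
  have nbv: "nb v = {x1, x2, x3}"
    using hole_degree(2)[OF hd] vx dist_x by (intro card3; blast)
  \<comment> \<open>The next vertex on the cycle must be one of the three known neighbours. Applied
    to \<open>a1\<close>, \<open>a2\<close> and \<open>a3\<close> in turn, this leaves exactly two
    vertices between consecutive members of N(v).\<close>
  have "E a1 (d ! 2)" using arcs_adj[OF d(1) arc[of 1]] ne(3) by (simp add: defs numeral_2_eq_2)
  then have "d ! 2 \<in> {d ! 0, d ! (g - 1), d ! (q - 1)}" using nbs(1) d0 by (auto simp: defs)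
  then have g3: "g = 3"
    using deq[of 2 0] deq[of 2 "g - 1"] deq[of 2 "q - 1"] g q g2 q2 ne(1) by auto
  have "E a2 (d ! 5)" using arcs_adj[OF d(1) arc[of 4]] g3 q q2 by (simp add: defs eval_nat_numeral)
  then have "d ! 5 \<in> {d ! 3, d ! (?n - 1), d ! (q - 1)}" using nbs(2) g3 dn by (auto simp: defs)
  then have q6: "q = 6"
    using deq[of 5 3] deq[of 5 "?n - 1"] deq[of 5 "q - 1"] q q2 g3 by auto
  have "a3 \<noteq> b1" using adj irrefl by blast
  then have "Suc q \<noteq> ?n - 1" using dn by (auto simp: defs)
  then have n8: "8 < ?n" using q q6 by auto
  then have "E a3 (d ! 8)" using arcs_adj[OF d(1) arc[of 7]] q6 by (simp add: defs eval_nat_numeral)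
  then have "d ! 8 \<in> {d ! 6, d ! (?n - 1), d ! 2}" using nbs(3) g3 q6 dn by (auto simp: defs)
  moreover have "d ! 8 \<noteq> d ! 6" "d ! 8 \<noteq> d ! 2" using deq[of 8 6] deq[of 8 2] n8 by simp_all
  ultimately have "d ! 8 = d ! (?n - 1)" by blast
  moreover have "?n - 1 < ?n" using n8 by linarith
  ultimately have "8 = ?n - 1" using deq[OF n8] by blast
  then have n9: "?n = 9" by linarith
  have "d = map (\<lambda>i. d ! i) [0..<9]" using n9 map_nth[of d] by simp
  also have "\<dots> = [d ! 0, d ! 1, d ! 2, d ! 3, d ! 4, d ! 5, d ! 6, d ! 7, d ! 8]"
    by (simp add: upt_rec numeral_eq_Suc)
  also have "\<dots> = [x1, a1, b2, x2, a2, b3, x3, a3, b1]"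
    using g3 q6 n9 dn d0 by (simp add: defs)
  finally have "d = [x1, a1, b2, x2, a2, b3, x3, a3, b1]" .
  then show thesis using that[of x1 a1 b2 x2 a2 b3 x3 a3 b1] hd nbv nbs by simp
qed

lemma hole_is_petersen:
  assumes h: "hole c v"
  shows "is_petersen V E"
proof -
  obtain x1 a1 b2 x2 a2 b3 x3 a3 b1
    where h': "hole [x1, a1, b2, x2, a2, b3, x3, a3, b1] v" and nbv: "nb v = {x1, x2, x3}"
    and nbs: "nb a1 = {x1, b2, b3}" "nb a2 = {x2, b1, b3}" "nb a3 = {x3, b1, b2}"
    "nb b1 = {x1, a2, a3}" "nb b2 = {x2, a1, a3}" "nb b3 = {x3, a1, a2}"
    using hole_nine_cycle[OF h] .
  let ?c = "[x1, a1, b2, x2, a2, b3, x3, a3, b1]"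
  have dist: "distinct (v # ?c)" using h' by (auto simp: longest_def is_cycle_def)
  have L: "L = 9" using h' by (simp add: longest_def)
  have adj: "E v y \<longleftrightarrow> y \<in> {x1, x2, x3}" "E a1 y \<longleftrightarrow> y \<in> {x1, b2, b3}" "E a2 y \<longleftrightarrow> y \<in> {x2, b1, b3}"
    "E a3 y \<longleftrightarrow> y \<in> {x3, b1, b2}" "E b1 y \<longleftrightarrow> y \<in> {x1, a2, a3}" "E b2 y \<longleftrightarrow> y \<in> {x2, a1, a3}"
    "E b3 y \<longleftrightarrow> y \<in> {x3, a1, a2}" for y
    unfolding nbs[symmetric] nbv[symmetric] by simp_all
  have adj': "E y v \<longleftrightarrow> y \<in> {x1, x2, x3}" "E y a1 \<longleftrightarrow> y \<in> {x1, b2, b3}" "E y a2 \<longleftrightarrow> y \<in> {x2, b1, b3}"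
    "E y a3 \<longleftrightarrow> y \<in> {x3, b1, b2}" "E y b1 \<longleftrightarrow> y \<in> {x1, a2, a3}" "E y b2 \<longleftrightarrow> y \<in> {x2, a1, a3}"
    "E y b3 \<longleftrightarrow> y \<in> {x3, a1, a2}" for y
    unfolding sym_iff[of y] by (rule adj)+
  \<comment> \<open>A further vertex \<open>w\<close> would be nonadjacent to \<open>v\<close> and
    to all a- and b-vertices; the edge \<open>a1 b2\<close> and the set \<open>{v, w, a2}\<close>
    would then contradict k = 3.\<close>
  have V: "V = insert v (set ?c)"
  proof (rule ccontr)
    assume "V \<noteq> insert v (set ?c)"
    moreover have "insert v (set ?c) \<subseteq> V" using h' longest_subset[of ?c] by blast
    ultimately obtain w where w: "w \<in> V" "w \<notin> insert v (set ?c)" by blast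
    have S: "{v, w, a2} \<subseteq> V" using w h' longest_subset[of ?c] by auto
    have ww: "\<not> E v w" "\<not> E w v" "\<not> E w a2" "\<not> E a2 w" "\<not> E a1 w" "\<not> E b2 w" "\<not> E w w"
      using w(2) irrefl by (auto simp: adj adj')
    have "E a1 b2" by (simp add: adj)
    moreover have "\<forall>x\<in>{v, w, a2}. \<forall>y\<in>{v, w, a2}. \<not> E x y"
      using ww irrefl dist by (auto simp: adj)
    moreover have "\<forall>s\<in>{v, w, a2}. \<not> E a1 s \<and> \<not> E b2 s"
      using ww dist by (auto simp: adj)
    ultimately have "card {v, w, a2} < k" using free[OF _ S] by blast
    moreover have "card {v, w, a2} = 3" using w(2) dist by auto
    ultimately show False using hole_degree(1)[OF h] by simp
  qed
  \<comment> \<open>A chord between two neighbours of \<open>v\<close> would close a cycle through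
    ten vertices, while \<open>L = 9\<close>.\<close>
  have nx: "\<not> E x1 x2" "\<not> E x2 x3" "\<not> E x3 x1"
  proof -
    show "\<not> E x1 x2"
    proof
      assume "E x1 x2"
      then have "is_cycle E [v, x1, x2, b2, a1, b3, a2, b1, a3, x3]"
        using dist by (auto simp: is_cycle_def adj adj')
      then show False using cycle_length_le L by fastforce
    qed
    show "\<not> E x2 x3"
    proof
      assume "E x2 x3"
      then have "is_cycle E [v, x2, x3, b3, a2, b1, a3, b2, a1, x1]"
        using dist by (auto simp: is_cycle_def adj adj')
      then show False using cycle_length_le L by fastforce
    qed
    show "\<not> E x3 x1"
    proof
      assume "E x3 x1"
      then have "is_cycle E [v, x3, x1, b1, a3, b2, a1, b3, a2, x2]"
        using dist by (auto simp: is_cycle_def adj adj')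
      then show False using cycle_length_le L by fastforce
    qed
  qed
  have adjx: "E x1 y \<longleftrightarrow> y \<in> {v, a1, b1}" "E x2 y \<longleftrightarrow> y \<in> {v, a2, b2}" "E x3 y \<longleftrightarrow> y \<in> {v, a3, b3}" for y
  proof -
    have "E x1 y \<Longrightarrow> y \<in> insert v (set ?c)" "E x2 y \<Longrightarrow> y \<in> insert v (set ?c)"
      "E x3 y \<Longrightarrow> y \<in> insert v (set ?c)" using in_V(2) V by blast+
    moreover have "\<not> E x2 x1" "\<not> E x3 x2" "\<not> E x1 x3" using nx sym by blast+
    ultimately show "E x1 y \<longleftrightarrow> y \<in> {v, a1, b1}" "E x2 y \<longleftrightarrow> y \<in> {v, a2, b2}" "E x3 y \<longleftrightarrow> y \<in> {v, a3, b3}"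
      using nx irrefl dist by (auto simp: adj')
  qed
  \<comment> \<open>The first five entries form the outer cycle and the last five the ends of their
    spokes, in the numbering of \<open>petersen_E\<close>.\<close>
  define l where "l = [v, x1, a1, b2, x2, x3, b1, b3, a3, a2]"
  have l_nth: "l ! 0 = v" "l ! 1 = x1" "l ! 2 = a1" "l ! 3 = b2" "l ! 4 = x2" "l ! 5 = x3" "l ! 6 = b1"
    "l ! 7 = b3" "l ! 8 = a3" "l ! 9 = a2"
    by (simp_all add: l_def)
  have l: "distinct l" "set l = V" "length l = 10" using dist V by (auto simp: l_def)
  have "bij_betw (\<lambda>i. l ! i) petersen_V V"
    using l by (intro bij_betw_nth) (auto simp: petersen_V_def lessThan_atLeast0)
  moreover have "petersen_E i j \<longleftrightarrow> E (l ! i) (l ! j)" if i: "i \<in> petersen_V" and j: "j \<in> petersen_V" for i j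
  proof -
    have range: "m \<in> {0, 1, 2, 3, 4, 5, 6, 7, 8, 9}" if "m \<in> petersen_V" for m
      using that by (auto simp: petersen_V_def)
    have eq: "l ! j = l ! m \<longleftrightarrow> j = m" if "m < 10" for m
      using that j l by (simp add: nth_eq_iff_index_eq petersen_V_def)
    have eqs: "l ! j = v \<longleftrightarrow> j = 0" "l ! j = x1 \<longleftrightarrow> j = 1" "l ! j = a1 \<longleftrightarrow> j = 2" "l ! j = b2 \<longleftrightarrow> j = 3"
      "l ! j = x2 \<longleftrightarrow> j = 4" "l ! j = x3 \<longleftrightarrow> j = 5" "l ! j = b1 \<longleftrightarrow> j = 6" "l ! j = b3 \<longleftrightarrow> j = 7"
      "l ! j = a3 \<longleftrightarrow> j = 8" "l ! j = a2 \<longleftrightarrow> j = 9"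
      using eq[of 0] eq[of 1] eq[of 2] eq[of 3] eq[of 4] eq[of 5] eq[of 6] eq[of 7] eq[of 8] eq[of 9]
      unfolding l_nth by simp_all
    have "j < 10" using j by (simp add: petersen_V_def)
    note table = petersen_adjacency[OF this]
    show ?thesis
      using range[OF i] by (elim insertE emptyE) (simp_all only: l_nth adj adjx insert_iff empty_iff eqs table simp_thms)
  qed
  ultimately show ?thesis unfolding is_petersen_def graph_iso_def by blast
qed

end

section \<open>Passing from the hypotheses to a longest cycle and a vertex outside it\<close>

theorem theorem1p6:
  fixes V :: "'a set" and E :: "'a \<Rightarrow> 'a \<Rightarrow> bool" and k :: nat
  assumes "simple_graph V E"
    and "k \<ge> 2"
    and "k_connected k V E"
    and "R_free (K2_kK1_V k) K2_kK1_E V E"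
    and "2 * real (min_degree V E) \<ge> 3 * (real k - 1)"
    and "2 * real (independence_number V E) \<le> real (card V)"
  shows "hamiltonian V E \<or> is_petersen V E"
proof -
  have fin: "finite V" and EV: "\<And>x y. E x y \<Longrightarrow> x \<in> V \<and> y \<in> V"
    using assms(1) by (auto simp: simple_graph_def)
  have len: "length c \<le> card V \<and> set c \<subseteq> V" if "is_cycle E c" for c
  proof -
    have "x \<in> V" if "x \<in> set c" for x
    proof -
      obtain y where "(x, y) \<in> arcs c" using arcs_succ_ex \<open>x \<in> set c\<close> by metis
      then have "E x y"
        using \<open>is_cycle E c\<close> unfolding arcs_iff is_cycle_def by (auto simp: successively_conv_nth)
      then show ?thesis using EV by blast
    qed
    then have "set c \<subseteq> V" by blast
    moreover have "distinct c" using that by (simp add: is_cycle_def)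
    ultimately show ?thesis using card_mono[OF fin] distinct_card by metis
  qed
  obtain c where c: "is_cycle E c" "\<And>c'. is_cycle E c' \<Longrightarrow> length c' \<le> length c"
  proof -
    obtain c0 where "is_cycle E c0" using k_connected_ex_cycle[OF assms(1,3,2)] by blast
    then show thesis
      using that ex_has_greatest_nat[of "is_cycle E" c0 length "Suc (card V)"] len by (metis less_Suc_eq_le)
  qed
  show ?thesis
  proof (cases "set c = V")
    case True
    have "E (c ! i) (c ! ((i + 1) mod length c))" if "i < length c" for i
    proof (cases "Suc i < length c")
      case True
      then show ?thesis using c(1) by (auto simp: is_cycle_def successively_conv_nth)
    next
      case False
      then have "Suc i = length c" using that by simp
      then have "i = length c - 1" "c \<noteq> []" "i + 1 = length c" by auto
      then have "last c = c ! i" "hd c = c ! 0" "(i + 1) mod length c = 0"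
        by (metis last_conv_nth, metis hd_conv_nth, metis mod_self)
      then show ?thesis using c(1) by (simp add: is_cycle_def)
    qed
    then show ?thesis using True c(1) unfolding hamiltonian_def is_cycle_def by blast
  next
    case False
    then obtain v where v: "v \<in> V" "v \<notin> set c" using len[OF c(1)] by blast
    interpret G: longest_cycle V E "length c"
      by unfold_locales (use assms(1) c(2) in auto)
    note free = K2_kK1_free_card[OF assms(1,4)]
    interpret G: edge_sparse_graph V E "length c" k
    proof
      show "2 \<le> k" by (rule assms(2))
    next
      show "E p q \<Longrightarrow> S \<subseteq> V \<Longrightarrow> \<forall>x\<in>S. \<forall>y\<in>S. \<not> E x y \<Longrightarrow>
        \<forall>s\<in>S. \<not> E p s \<and> \<not> E q s \<Longrightarrow> card S < k" for p q S by (rule free)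
    next
      show "k \<le> card {y. E x y}" if "x \<in> V" for x by (rule k_connected_degree[OF assms(1,3) that])
    next
      \<comment> \<open>The degree hypothesis in natural numbers, with 3 added on the right to avoid
        truncated subtraction.\<close>
      show "3 * k \<le> 2 * card {y. E x y} + 3" if "x \<in> V" for x
      proof -
        have "{u \<in> V. E x u} = {y. E x y}" using EV by blast
        then have "min_degree V E \<le> card {y. E x y}"
          unfolding min_degree_def using fin that by (metis Defs.degree_def Min_le finite_imageI imageI)
        then have "real (min_degree V E) \<le> real (card {y. E x y})" by simp
        then have "real (3 * k) \<le> real (2 * card {y. E x y} + 3)" using assms(5) by simp
        then show ?thesis by (simp only: of_nat_le_iff)
      qed
    next
      show "\<not> E u w" if "G.longest d" "u \<notin> set d" "w \<notin> set d" for d u w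
        by (rule G.outside_independent_if_k_connected[OF assms(3) _ that]) (rule free)
    next
      show "2 * card S \<le> card V" if "S \<subseteq> V" "\<forall>x\<in>S. \<forall>y\<in>S. \<not> E x y" for S
      proof -
        have "finite {S. independent_set V E S}"
          by (rule finite_subset[of _ "Pow V"]) (use fin in \<open>auto simp: independent_set_def\<close>)
        moreover have "S \<in> {S. independent_set V E S}" using that by (simp add: independent_set_def)
        ultimately have "card S \<le> independence_number V E"
          unfolding independence_number_def by (intro Max_ge finite_imageI imageI)
        then have "real (card S) \<le> real (independence_number V E)" by simp
        then have "real (2 * card S) \<le> real (card V)" using assms(6) by simp
        then show ?thesis by (simp only: of_nat_le_iff)
      qed
    qed
    have "is_petersen V E"
      by (rule G.hole_is_petersen[of c v]) (use c(1) v in \<open>auto simp: G.longest_def\<close>)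
    then show ?thesis by blast
  qed
qed

end
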